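(* Let $q$ be an odd prime power. Then $\mathfrak{X}(\mathrm{P}\Gamma\mathrm{L}(2,q),\mathcal{L}_+)$ is a symmetric association scheme, whose relations are the following: $$R_0=\{(L_{\xi,\gamma},L_{\xi,\gamma})\mid \{\xi,\gamma\}\subset\mathbb{F}_q\cup\{\infty\},\ \xi\neq\gamma\},$$ $$R_1=\{(L_{\xi,\gamma},L_{\xi,\beta})\mid \{\xi,\gamma,\beta\}\subset\mathbb{F}_q\cup\{\infty\},\ \xi,\gamma,\beta\text{ distinct}\},$$ $$R_{-1}=\{(L_{\xi,\gamma},L_{\alpha,\beta})\mid \{\xi,\gamma,\alpha,\beta\}\subset\mathbb{F}_q\cup\{\infty\}\text{ distinct},\ \mathrm{cr}(\xi,\gamma;\alpha,\beta)=-1\},$$ $$R_r=\{(L_{\xi,\gamma},L_{\alpha,\beta})\mid \{\xi,\gamma,\alpha,\beta\}\subset\mathbb{F}_q\cup\{\infty\}\text{ distinct},\ \mathrm{cr}(\xi,\gamma;\alpha,\beta)\in\{r^\tau,r^{-\tau}\mid\tau\in\mathrm{Aut}(\mathbb{F}_q)\}\},\quad r\in\mathbb{F}_q^*\setminus\{\pm1\},$$ where $R_r$ and $R_{r'}$ denote the same relation whenever $r'\in\{r^\tau,r^{-\tau}\mid \tau\in\mathrm{Aut}(\mathbb{F}_q)\}$.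
   Context: Association schemes: if a group $G$ acts transitively on a finite set $X$, the orbits of the induced diagonal action of $G$ on $X\times X$ are the relations of an association scheme, denoted $\mathfrak{X}(G,X)$. The scheme is symmetric if for each relation $R$, $(x,y)\in R$ implies $(y,x)\in R$. Cross-ratio: $\mathrm{cr}(x,y;z,w)=\frac{(x-z)(y-w)}{(x-w)(y-z)}$ for distinct $x,y,z,w\in\mathbb{F}_q\cup\{\infty\}$, with the usual limit conventions when one of the entries is $\infty$. Here $r^\tau$ is the image of $r$ under $\tau$ and $r^{-\tau}=(r^\tau)^{-1}$. Hyperbolic lines and the action: in $\mathrm{PG}(2,q)$ let $P_\xi=(\xi^2:\xi:1)$ for $\xi\in\mathbb{F}_q$, $P_\infty=(1:0:0)$, and let $\mathscr{O}=\{P_\xi\mid \xi\in\mathbb{F}_q\cup\{\infty\}\}$, a conic. A line is hyperbolic if it meets $\mathscr{O}$ in exactly 2 points; $\mathcal{L}_+$ is the set of hyperbolic lines, i.e. the lines $L_{\xi,\gamma}=L_{\gamma,\xi}$ through $P_\xi$ and $P_\gamma$ for distinct $\xi,\gamma\in\mathbb{F}_q\cup\{\infty\}$. The group $\mathrm{P}\Gamma\mathrm{L}(2,q)$ consists of the permutations $\xi\mapsto\frac{a\xi^\tau+b}{c\xi^\tau+d}$ of $\mathrm{PG}(1,q)=\mathbb{F}_q\cup\{\infty\}$, with $ad-bc\neq0$ and $\tau\in\mathrm{Aut}(\mathbb{F}_q)$. It acts on $\mathrm{PG}(2,q)$ through the embedding into $\mathrm{P}\Gamma\mathrm{L}(3,q)$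 sending the class of $\left(\begin{pmatrix} a&b\\c&d\end{pmatrix},\tau\right)$ to the class of $v\mapsto \begin{pmatrix} a^2&2ab&b^2\\ ac&ad+bc&bd\\ c^2&2cd&d^2\end{pmatrix}v^\tau$, where $v^\tau$ is obtained by applying $\tau$ to the coordinates. This action preserves $\mathscr{O}$, and $g$ maps $L_{\xi,\gamma}$ to $L_{g(\xi),g(\gamma)}$; the resulting action on $\mathcal{L}_+$ is transitive. *)

theory Defs
  imports
    "HOL-Analysis.Cartesian_Space"
    "HOL-Algebra.Group_Action"
    "HOL-Library.Disjoint_Sets"
    "HOL-Number_Theory.Prime_Powers"
begin

section \<open>Association schemes\<close>

text \<open>Commutativity is not part of the definition; it follows from symmetry.\<close>

definition association_scheme :: "'x set \<Rightarrow> ('x \<times> 'x) set set \<Rightarrow> bool" where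
  "association_scheme X \<R> \<longleftrightarrow>
     finite X \<and> X \<noteq> {} \<and> partition_on (X \<times> X) \<R> \<and> Id_on X \<in> \<R> \<and>
     (\<forall>R\<in>\<R>. R\<inverse> \<in> \<R>) \<and>
     (\<forall>R\<in>\<R>. \<forall>S\<in>\<R>. \<forall>T\<in>\<R>. \<exists>p. \<forall>(x, y)\<in>T. card {z \<in> X. (x, z) \<in> R \<and> (z, y) \<in> S} = p)"

definition symmetric_association_scheme :: "'x set \<Rightarrow> ('x \<times> 'x) set set \<Rightarrow> bool" where
  "symmetric_association_scheme X \<R> \<longleftrightarrow> association_scheme X \<R> \<and> (\<forall>R\<in>\<R>. sym R)"

text \<open>The set of relations of the scheme of a transitive action \<open>\<phi>\<close> of \<open>G\<close> on \<open>X\<close>.\<close>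

definition orbital_relations ::
    "('g, 'm) monoid_scheme \<Rightarrow> 'x set \<Rightarrow> ('g \<Rightarrow> 'x \<Rightarrow> 'x) \<Rightarrow> ('x \<times> 'x) set set" where
  "orbital_relations G X \<phi> =
     orbits G (X \<times> X) (\<lambda>g. \<lambda>p\<in>X \<times> X. (\<phi> g (fst p), \<phi> g (snd p)))"


section \<open>The projective line and its semilinear group\<close>

text \<open>\<open>PG(1,q)\<close> is the type \<open>'a option\<close> over the field \<open>'a\<close>, with \<open>None\<close> as the point
  \<open>\<infinity>\<close>.\<close>

definition field_auts :: "('a::field \<Rightarrow> 'a) set" where
  "field_auts = {\<tau>. bij \<tau> \<and> (\<forall>x y. \<tau> (x + y) = \<tau> x + \<tau> y) \<and> (\<forall>x y. \<tau> (x * y) = \<tau> x * \<tau> y)}"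

definition proj_quot :: "'a::field \<Rightarrow> 'a \<Rightarrow> 'a option" where
  "proj_quot u v = (if v = 0 then None else Some (u / v))"

definition semilinear_frac ::
    "'a::field \<Rightarrow> 'a \<Rightarrow> 'a \<Rightarrow> 'a \<Rightarrow> ('a \<Rightarrow> 'a) \<Rightarrow> 'a option \<Rightarrow> 'a option" where
  "semilinear_frac a b c d \<tau> \<xi> =
     (case \<xi> of Some x \<Rightarrow> proj_quot (a * \<tau> x + b) (c * \<tau> x + d) | None \<Rightarrow> proj_quot a c)"

definition PGammaL2 :: "('a::field option \<Rightarrow> 'a option) monoid" where
  "PGammaL2 = BijGroup UNIV
     \<lparr>carrier := {semilinear_frac a b c d \<tau> | a b c d \<tau>. a * d - b * c \<noteq> 0 \<and> \<tau> \<in> field_auts}\<rparr>"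

text \<open>Only meaningful for four distinct arguments.\<close>

fun cross_ratio :: "'a::field option \<Rightarrow> 'a option \<Rightarrow> 'a option \<Rightarrow> 'a option \<Rightarrow> 'a" where
  "cross_ratio (Some x) (Some y) (Some z) (Some w) = ((x - z) * (y - w)) / ((x - w) * (y - z))"
| "cross_ratio None (Some y) (Some z) (Some w) = (y - w) / (y - z)"
| "cross_ratio (Some x) None (Some z) (Some w) = (x - z) / (x - w)"
| "cross_ratio (Some x) (Some y) None (Some w) = (y - w) / (x - w)"
| "cross_ratio (Some x) (Some y) (Some z) None = (x - z) / (y - z)"
| "cross_ratio _ _ _ _ = 0"


section \<open>The projective plane, the conic and hyperbolic lines\<close>

text \<open>A point of \<open>PG(2,q)\<close> is a one-dimensional subspace of \<open>'a ^ 3\<close>, and a line is the set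
  of points contained in a two-dimensional subspace.\<close>

type_synonym 'a point = "('a ^ 3) set"
type_synonym 'a line = "'a point set"

definition pg2_points :: "'a::field point set" where
  "pg2_points = {P. vec.subspace P \<and> vec.dim P = 1}"

definition pg2_lines :: "'a::field line set" where
  "pg2_lines = {{P \<in> pg2_points. P \<subseteq> W} | W. vec.subspace W \<and> vec.dim W = 2}"

definition conic_point :: "'a::field option \<Rightarrow> 'a point" where
  "conic_point \<xi> =
     vec.span {case \<xi> of Some x \<Rightarrow> vector [x\<^sup>2, x, 1] | None \<Rightarrow> vector [1, 0, 0]}"

definition conic :: "'a::field point set" where
  "conic = range conic_point"

definition hyperbolic_lines :: "'a::field line set" where
  "hyperbolic_lines = {l \<in> pg2_lines. card (l \<inter> conic) = 2}"

text \<open>The line \<open>L\<^sub>\<xi>\<^sub>\<gamma>\<close> through \<open>P\<^sub>\<xi>\<close> and \<open>P\<^sub>\<gamma>\<close>, for \<open>\<xi> \<noteq> \<gamma>\<close>.\<close>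

definition secant :: "'a::field option \<Rightarrow> 'a option \<Rightarrow> 'a line" where
  "secant \<xi> \<gamma> = {P \<in> pg2_points. P \<subseteq> vec.span (conic_point \<xi> \<union> conic_point \<gamma>)}"


section \<open>The action on hyperbolic lines\<close>

definition sym_square :: "'a::field \<Rightarrow> 'a \<Rightarrow> 'a \<Rightarrow> 'a \<Rightarrow> 'a ^ 3 ^ 3" where
  "sym_square a b c d = vector
     [vector [a\<^sup>2, 2 * a * b, b\<^sup>2],
      vector [a * c, a * d + b * c, b * d],
      vector [c\<^sup>2, 2 * c * d, d\<^sup>2]]"

definition semilinear_map :: "'a::field ^ 3 ^ 3 \<Rightarrow> ('a \<Rightarrow> 'a) \<Rightarrow> 'a ^ 3 \<Rightarrow> 'a ^ 3" where
  "semilinear_map M \<tau> v = M *v (\<chi> i. \<tau> (v $ i))"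

text \<open>The permutation of the points of \<open>PG(2,q)\<close> induced by \<open>g\<close>. It does not depend on the
  coefficients \<open>a, b, c, d\<close> chosen to represent \<open>g\<close>: they are unique up to a common scalar, and
  a scalar acts trivially on one-dimensional subspaces (hence the restriction to
  \<open>pg2_points\<close>).\<close>

definition plane_action :: "('a::field option \<Rightarrow> 'a option) \<Rightarrow> 'a point \<Rightarrow> 'a point" where
  "plane_action g = (THE h. \<exists>a b c d \<tau>. a * d - b * c \<noteq> 0 \<and> \<tau> \<in> field_auts \<and>
     g = semilinear_frac a b c d \<tau> \<and>
     h = (\<lambda>P\<in>pg2_points. semilinear_map (sym_square a b c d) \<tau> ` P))"

definition line_action :: "('a::field option \<Rightarrow> 'a option) \<Rightarrow> 'a line \<Rightarrow> 'a line" where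
  "line_action g = (\<lambda>l\<in>hyperbolic_lines. plane_action g ` l)"


section \<open>The relations\<close>

definition rel_0 :: "('a::field line \<times> 'a line) set" where
  "rel_0 = {(secant \<xi> \<gamma>, secant \<xi> \<gamma>) | \<xi> \<gamma>. \<xi> \<noteq> \<gamma>}"

definition rel_1 :: "('a::field line \<times> 'a line) set" where
  "rel_1 = {(secant \<xi> \<gamma>, secant \<xi> \<beta>) | \<xi> \<gamma> \<beta>. distinct [\<xi>, \<gamma>, \<beta>]}"

definition rel_minus_1 :: "('a::field line \<times> 'a line) set" where
  "rel_minus_1 = {(secant \<xi> \<gamma>, secant \<alpha> \<beta>) | \<xi> \<gamma> \<alpha> \<beta>.
     distinct [\<xi>, \<gamma>, \<alpha>, \<beta>] \<and> cross_ratio \<xi> \<gamma> \<alpha> \<beta> = - 1}"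

definition aut_class :: "'a::field \<Rightarrow> 'a set" where
  "aut_class r = {\<tau> r | \<tau>. \<tau> \<in> field_auts} \<union> {inverse (\<tau> r) | \<tau>. \<tau> \<in> field_auts}"

definition rel :: "'a::field \<Rightarrow> ('a line \<times> 'a line) set" where
  "rel r = {(secant \<xi> \<gamma>, secant \<alpha> \<beta>) | \<xi> \<gamma> \<alpha> \<beta>.
     distinct [\<xi>, \<gamma>, \<alpha>, \<beta>] \<and> cross_ratio \<xi> \<gamma> \<alpha> \<beta> \<in> aut_class r}"

end

theory Submission
  imports Defs
begin

text \<open>Everything happens on the projective line. A secant meets the conic exactly in the two points
  that span it, so hyperbolic lines are the same as unordered pairs of distinct points of
  \<open>PG(1,q)\<close> (\<open>secant_eq_iff\<close>, \<open>hyperbolic_lines_eq\<close>), and the plane action moves a secant by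
  moving its two parameters (\<open>line_action_secant\<close>). The reason for the latter is that the
  symmetric square of a matrix maps the Veronese vector \<open>(u\<^sup>2, uv, v\<^sup>2)\<close> to the Veronese vector of
  the image of \<open>(u, v)\<close>.

  The relations are then the orbits of the semilinear group on pairs of unordered pairs. The
  group is transitive on ordered triples of distinct points, which makes it transitive on lines and
  gives one orbit of equal lines and one of distinct lines that share a conic point. If the two
  lines have four distinct parameters, a group element with field automorphism \<open>\<tau>\<close> turns their
  cross-ratio \<open>r\<close> into \<open>\<tau> r\<close>. Conversely, every such quadruple can be moved to
  \<open>(\<infinity>, 0, 1, r)\<close>, and \<open>\<tau>\<close> acting on the coordinate moves this to \<open>(\<infinity>, 0, 1, \<tau> r)\<close>; so the
  cross-ratio up to automorphisms classifies ordered quadruples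
  (\<open>PGammaL2_cross_ratio_transitive\<close>). Exchanging the two parameters of one of the lines inverts
  the cross-ratio, which is why orbits correspond to the classes \<open>aut_class r\<close>
  (\<open>pair_orbit_disjoint\<close>, \<open>rel_eq_iff\<close>). The value \<open>-1\<close> is fixed by automorphisms and by inversion,
  and it occurs as a cross-ratio because it differs from \<open>1\<close> when \<open>q\<close> is odd.

  Exchanging the two lines preserves the cross-ratio, so every orbit is symmetric. For a transitive
  action, symmetry of all orbits on pairs is all that has to be checked for a symmetric association
  scheme: the intersection numbers are constant because a group element maps the set counted for
  one pair bijectively to the set counted for its image
  (\<open>symmetric_association_scheme_orbital_relations\<close>).\<close>

section \<open>Schemes of transitive actions\<close>

lemma (in group_action) group_action_pairs:
  "group_action G (E \<times> E) (\<lambda>g. \<lambda>p\<in>E \<times> E. (\<phi> g (fst p), \<phi> g (snd p)))"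
    (is "group_action G _ ?\<psi>")
proof -
  interpret group_hom G "BijGroup E" \<phi> by (rule group_hom)
  have bij: "?\<psi> g \<in> Bij (E \<times> E)" if "g \<in> carrier G" for g
  proof -
    have b: "bij_betw (\<phi> g) E E" using bij_prop0[OF that] by (simp add: Bij_def)
    have "bij_betw (map_prod (\<phi> g) (\<phi> g)) (E \<times> E) (E \<times> E)"
      by (rule bij_betw_map_prod[OF b b])
    then have "bij_betw (?\<psi> g) (E \<times> E) (E \<times> E)"
      by (rule iffD1[OF bij_betw_cong, rotated]) (auto simp: map_prod_def)
    then show ?thesis by (simp add: Bij_def)
  qed
  have "?\<psi> (g \<otimes>\<^bsub>G\<^esub> h) = compose (E \<times> E) (?\<psi> g) (?\<psi> h)"
    if "g \<in> carrier G" "h \<in> carrier G" for g h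
    using that composition_rule element_image[OF that(2) _ refl]
    by (simp add: compose_def fun_eq_iff restrict_def)
  then have "?\<psi> \<in> hom G (BijGroup (E \<times> E))"
    using bij by (auto simp: hom_def BijGroup_def)
  then show ?thesis
    unfolding group_action_def group_hom_def group_hom_axioms_def
    by (simp add: G.group_axioms group_BijGroup)
qed

lemma (in group_action) orbit_pair:
  assumes "x \<in> E" "y \<in> E"
  shows "orbit G (\<lambda>g. \<lambda>p\<in>E \<times> E. (\<phi> g (fst p), \<phi> g (snd p))) (x, y) =
    {(\<phi> g x, \<phi> g y) | g. g \<in> carrier G}"
  using assms by (auto simp: orbit_def)

lemma (in group_action) orbital_relations_eq:
  "orbital_relations G E \<phi> =
    {{(\<phi> g x, \<phi> g y) | g. g \<in> carrier G} | x y. x \<in> E \<and> y \<in> E}"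
  (is "?L = ?R")
proof -
  have "?L = (\<lambda>p. orbit G (\<lambda>g. \<lambda>p\<in>E \<times> E. (\<phi> g (fst p), \<phi> g (snd p))) p) ` (E \<times> E)"
    unfolding orbital_relations_def orbits_def by (rule Setcompr_eq_image)
  also have "\<dots> = (\<lambda>(x, y). {(\<phi> g x, \<phi> g y) | g. g \<in> carrier G}) ` (E \<times> E)"
    by (rule image_cong[OF refl]) (clarsimp simp: orbit_pair)
  also have "\<dots> = ?R" by (simp add: image_def) blast
  finally show ?thesis .
qed

lemma (in group_action) partition_on_orbital_relations:
  "partition_on (E \<times> E) (orbital_relations G E \<phi>)"
proof -
  interpret P: group_action G "E \<times> E" "\<lambda>g. \<lambda>p\<in>E \<times> E. (\<phi> g (fst p), \<phi> g (snd p))"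
    by (rule group_action_pairs)
  have "{} \<notin> orbital_relations G E \<phi>"
    unfolding orbital_relations_def orbits_def using P.orbit_refl by blast
  then show ?thesis
    unfolding partition_on_def disjoint_def
    using P.orbits_coverture P.disjoint_union
    unfolding orbital_relations_def[symmetric] by blast
qed

text \<open>From left to right, move the pair back with the inverse of \<open>g\<close>.\<close>

lemma (in group_action) orbital_relation_invariant:
  assumes R: "R \<in> orbital_relations G E \<phi>" and g: "g \<in> carrier G"
    and x: "x \<in> E" and y: "y \<in> E"
  shows "(\<phi> g x, \<phi> g y) \<in> R \<longleftrightarrow> (x, y) \<in> R"
proof -
  interpret group G using group_hom group_hom.axioms(1) by blast
  have move: "(\<phi> h u, \<phi> h v) \<in> R" if uv: "(u, v) \<in> R" and h: "h \<in> carrier G" for h u v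
  proof -
    obtain x0 y0 where 0: "x0 \<in> E" "y0 \<in> E"
      and Req: "R = {(\<phi> g x0, \<phi> g y0) | g. g \<in> carrier G}"
      using R unfolding orbital_relations_eq by blast
    obtain k where k: "k \<in> carrier G" "u = \<phi> k x0" "v = \<phi> k y0"
      using uv unfolding Req by auto
    have "\<phi> h u = \<phi> (h \<otimes>\<^bsub>G\<^esub> k) x0" "\<phi> h v = \<phi> (h \<otimes>\<^bsub>G\<^esub> k) y0"
      using composition_rule 0 k h by auto
    then show ?thesis
      unfolding Req using k h by (intro CollectI exI[of _ "h \<otimes>\<^bsub>G\<^esub> k"]) simp
  qed
  show ?thesis
    using move[of x y g] move[of "\<phi> g x" "\<phi> g y" "inv\<^bsub>G\<^esub> g"] g
      orbit_sym_aux[OF g x refl] orbit_sym_aux[OF g y refl] by auto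
qed

text \<open>The intersection number of \<open>R\<close> and \<open>S\<close> at \<open>(x, y)\<close> counts a set that \<open>\<phi> g\<close> maps onto the set
  counted at \<open>(\<phi> g x, \<phi> g y)\<close>, because \<open>R\<close> and \<open>S\<close> are invariant. The diagonal is an orbit by
  transitivity, and symmetric relations are their own converses.\<close>

lemma (in transitive_action) symmetric_association_scheme_orbital_relations:
  assumes fin: "finite E" and ne: "E \<noteq> {}"
    and sym: "\<And>R. R \<in> orbital_relations G E \<phi> \<Longrightarrow> sym R"
  shows "symmetric_association_scheme E (orbital_relations G E \<phi>)"
proof -
  obtain x0 where x0: "x0 \<in> E" using ne by blast
  have "Id_on E = {(\<phi> g x0, \<phi> g x0) | g. g \<in> carrier G}"
    using unique_orbit[OF x0] element_image[OF _ x0] by (fastforce simp: Id_on_def)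
  then have id: "Id_on E \<in> orbital_relations G E \<phi>"
    unfolding orbital_relations_eq using x0 by blast
  have num: "\<exists>p. \<forall>(x, y)\<in>T. card {z \<in> E. (x, z) \<in> R \<and> (z, y) \<in> S} = p"
    if RST: "R \<in> orbital_relations G E \<phi>" "S \<in> orbital_relations G E \<phi>"
      "T \<in> orbital_relations G E \<phi>" for R S T
  proof -
    let ?A = "\<lambda>x y. {z \<in> E. (x, z) \<in> R \<and> (z, y) \<in> S}"
    obtain x y where xy: "x \<in> E" "y \<in> E"
      and T: "T = {(\<phi> g x, \<phi> g y) | g. g \<in> carrier G}"
      using RST(3) unfolding orbital_relations_eq by blast
    have "card (?A (\<phi> g x) (\<phi> g y)) = card (?A x y)" if g: "g \<in> carrier G" for g
    proof -
      have "?A (\<phi> g x) (\<phi> g y) = \<phi> g ` ?A x y"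
      proof (intro equalityI subsetI)
        fix w assume w: "w \<in> ?A (\<phi> g x) (\<phi> g y)"
        then obtain z where "z \<in> E" "w = \<phi> g z" using surj_prop[OF g] by blast
        then show "w \<in> \<phi> g ` ?A x y"
          using w orbital_relation_invariant[OF RST(1) g xy(1)]
            orbital_relation_invariant[OF RST(2) g _ xy(2)] by auto
      next
        fix w assume "w \<in> \<phi> g ` ?A x y"
        then show "w \<in> ?A (\<phi> g x) (\<phi> g y)"
          using orbital_relation_invariant[OF RST(1) g xy(1)] element_image[OF g]
            orbital_relation_invariant[OF RST(2) g _ xy(2)] by auto
      qed
      moreover have "inj_on (\<phi> g) (?A x y)"
        using inj_prop[OF g] by (rule inj_on_subset) auto
      ultimately show ?thesis by (simp add: card_image)
    qed
    then show ?thesis using T by auto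
  qed
  have "R\<inverse> \<in> orbital_relations G E \<phi>" if "R \<in> orbital_relations G E \<phi>" for R
    using sym[OF that] that by (simp add: sym_conv_converse_eq)
  then show ?thesis
    unfolding symmetric_association_scheme_def association_scheme_def
    using fin ne partition_on_orbital_relations id num sym by blast
qed

section \<open>Field automorphisms\<close>

lemma field_autsD:
  assumes "\<tau> \<in> field_auts"
  shows "\<tau> (x + y) = \<tau> x + \<tau> y" "\<tau> (x * y) = \<tau> x * \<tau> y" "bij \<tau>"
    "\<tau> 0 = 0" "\<tau> 1 = 1" "\<tau> (- x) = - \<tau> x" "\<tau> (x - y) = \<tau> x - \<tau> y"
    "\<tau> x = 0 \<longleftrightarrow> x = 0" "\<tau> (inverse x) = inverse (\<tau> x)" "\<tau> (x / y) = \<tau> x / \<tau> y"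
    "\<tau> (x ^ n) = \<tau> x ^ n"
proof -
  show add: "\<tau> (x + y) = \<tau> x + \<tau> y" for x y using assms by (simp add: field_auts_def)
  show mult: "\<tau> (x * y) = \<tau> x * \<tau> y" for x y using assms by (simp add: field_auts_def)
  show bij: "bij \<tau>" using assms by (simp add: field_auts_def)
  show zero: "\<tau> 0 = 0" using add[of 0 0] by (metis add_0 add_cancel_right_right)
  show eq_zero: "\<tau> x = 0 \<longleftrightarrow> x = 0" for x
    using bij zero by (metis bij_pointE)
  show one: "\<tau> 1 = 1" using mult[of 1 1] eq_zero[of 1] by simp
  show minus: "\<tau> (- x) = - \<tau> x" for x
    using add[of x "- x"] zero by (simp add: eq_neg_iff_add_eq_0 add.commute)
  show "\<tau> (x - y) = \<tau> x - \<tau> y" using add[of x "- y"] minus by simp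
  show inv: "\<tau> (inverse x) = inverse (\<tau> x)" for x
  proof (cases "x = 0")
    case False
    then have "\<tau> x * \<tau> (inverse x) = 1" using one mult[of x "inverse x"] by simp
    then show ?thesis by (metis inverse_unique)
  qed (simp add: zero)
  show "\<tau> (x / y) = \<tau> x / \<tau> y" by (simp add: divide_inverse mult inv)
  show "\<tau> (x ^ n) = \<tau> x ^ n" by (induction n) (simp_all add: one mult)
qed

lemma field_auts_id: "(\<lambda>x. x) \<in> field_auts"
  by (auto simp: field_auts_def bij_def inj_def surj_def)

lemma field_auts_comp: "\<sigma> \<in> field_auts \<Longrightarrow> \<tau> \<in> field_auts \<Longrightarrow> (\<lambda>x. \<sigma> (\<tau> x)) \<in> field_auts"
  using bij_comp[of \<tau> \<sigma>] by (simp add: field_auts_def o_def)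

lemma field_auts_inv:
  assumes "\<tau> \<in> field_auts"
  shows "inv_into UNIV \<tau> \<in> field_auts" "\<tau> (inv_into UNIV \<tau> x) = x" "inv_into UNIV \<tau> (\<tau> x) = x"
proof -
  have b: "bij \<tau>" using assms by (rule field_autsD)
  show 1: "\<tau> (inv_into UNIV \<tau> x) = x" for x using b by (simp add: bij_is_surj surj_f_inv_f)
  show 2: "inv_into UNIV \<tau> (\<tau> x) = x" for x using b by (simp add: bij_is_inj)
  have "inv_into UNIV \<tau> (x + y) = inv_into UNIV \<tau> x + inv_into UNIV \<tau> y" for x y
    using 2[of "inv_into UNIV \<tau> x + inv_into UNIV \<tau> y"] by (simp add: field_autsD[OF assms] 1)
  moreover have "inv_into UNIV \<tau> (x * y) = inv_into UNIV \<tau> x * inv_into UNIV \<tau> y" for x y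
    using 2[of "inv_into UNIV \<tau> x * inv_into UNIV \<tau> y"] by (simp add: field_autsD[OF assms] 1)
  ultimately show "inv_into UNIV \<tau> \<in> field_auts"
    using bij_imp_bij_inv[OF b] by (simp add: field_auts_def)
qed

section \<open>Homogeneous coordinates on the projective line\<close>

text \<open>The point \<open>\<xi>\<close> has the homogeneous coordinates \<open>(num \<xi> : den \<xi>)\<close>. Working with them treats
  \<open>\<infinity>\<close> like any other point, so that the group laws and cross-ratios become polynomial
  identities.\<close>

definition num :: "'a::field option \<Rightarrow> 'a" where
  "num \<xi> = (case \<xi> of None \<Rightarrow> 1 | Some x \<Rightarrow> x)"

definition den :: "'a::field option \<Rightarrow> 'a" where
  "den \<xi> = (case \<xi> of None \<Rightarrow> 0 | Some x \<Rightarrow> 1)"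

lemma num_den_simps [simp]:
  "num None = 1" "den None = 0" "num (Some x) = x" "den (Some x) = 1"
  by (simp_all add: num_def den_def)

lemma num_den_nonzero: "num \<xi> \<noteq> 0 \<or> den \<xi> \<noteq> 0"
  by (cases \<xi>) simp_all

lemma proj_quot_num_den: "proj_quot (num \<xi>) (den \<xi>) = \<xi>"
  by (cases \<xi>) (simp_all add: proj_quot_def)

lemma proj_quot_scale: "k \<noteq> 0 \<Longrightarrow> proj_quot (k * u) (k * v) = proj_quot u v"
  by (simp add: proj_quot_def)

lemma proj_quot_coords:
  assumes "u \<noteq> 0 \<or> v \<noteq> 0"
  obtains k where "k \<noteq> 0" "u = k * num (proj_quot u v)" "v = k * den (proj_quot u v)"
proof (cases "v = 0")
  case True
  then show ?thesis using that[of u] assms by (simp add: proj_quot_def)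
next
  case False
  then show ?thesis using that[of v] by (simp add: proj_quot_def)
qed

lemma proj_quot_eqD:
  assumes "u \<noteq> 0 \<or> v \<noteq> 0" "u' \<noteq> 0 \<or> v' \<noteq> 0" "proj_quot u v = proj_quot u' v'"
  obtains k where "k \<noteq> 0" "u' = k * u" "v' = k * v"
proof -
  obtain k where k: "k \<noteq> 0" "u = k * num (proj_quot u v)" "v = k * den (proj_quot u v)"
    using proj_quot_coords[OF assms(1)] by blast
  obtain l where l: "l \<noteq> 0" "u' = l * num (proj_quot u v)" "v' = l * den (proj_quot u v)"
    using proj_quot_coords[OF assms(2)] assms(3) by metis
  show ?thesis
  proof (rule that[of "l / k"])
    show "l / k \<noteq> 0" using k l by simp
    have "l / k * u = l / k * (k * num (proj_quot u v))" using k(2) by simp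
    then show "u' = l / k * u" using k(1) l(2) by simp
    have "l / k * v = l / k * (k * den (proj_quot u v))" using k(3) by simp
    then show "v' = l / k * v" using k(1) l(3) by simp
  qed
qed

lemma invertible_image_nonzero:
  fixes a b c d u v :: "'a::field"
  assumes "a * d - b * c \<noteq> 0" "u \<noteq> 0 \<or> v \<noteq> 0"
  shows "a * u + b * v \<noteq> 0 \<or> c * u + d * v \<noteq> 0"
proof (rule ccontr)
  assume "\<not> ?thesis"
  then have 0: "a * u + b * v = 0" "c * u + d * v = 0" by auto
  have "(a * d - b * c) * u = d * (a * u + b * v) - b * (c * u + d * v)"
    "(a * d - b * c) * v = a * (c * u + d * v) - c * (a * u + b * v)" by algebra+
  then show False using assms 0 by simp
qed

lemma semilinear_frac_num_den:
  assumes "\<tau> \<in> field_auts"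
  shows "semilinear_frac a b c d \<tau> \<xi> =
    proj_quot (a * \<tau> (num \<xi>) + b * \<tau> (den \<xi>)) (c * \<tau> (num \<xi>) + d * \<tau> (den \<xi>))"
  by (cases \<xi>) (simp_all add: semilinear_frac_def field_autsD[OF assms])

lemma semilinear_frac_coords:
  assumes det: "a * d - b * c \<noteq> 0" and \<tau>: "\<tau> \<in> field_auts"
  obtains k where "k \<noteq> 0"
    "a * \<tau> (num \<xi>) + b * \<tau> (den \<xi>) = k * num (semilinear_frac a b c d \<tau> \<xi>)"
    "c * \<tau> (num \<xi>) + d * \<tau> (den \<xi>) = k * den (semilinear_frac a b c d \<tau> \<xi>)"
proof -
  have "\<tau> (num \<xi>) \<noteq> 0 \<or> \<tau> (den \<xi>) \<noteq> 0"
    using num_den_nonzero[of \<xi>] by (simp add: field_autsD[OF \<tau>])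
  from invertible_image_nonzero[OF det this] show ?thesis
    using proj_quot_coords that unfolding semilinear_frac_num_den[OF \<tau>] by blast
qed

lemma semilinear_frac_proj_quot:
  assumes "\<tau> \<in> field_auts" "u \<noteq> 0 \<or> v \<noteq> 0"
  shows "semilinear_frac a b c d \<tau> (proj_quot u v) =
    proj_quot (a * \<tau> u + b * \<tau> v) (c * \<tau> u + d * \<tau> v)"
proof -
  obtain k where k: "k \<noteq> 0" "u = k * num (proj_quot u v)" "v = k * den (proj_quot u v)"
    using proj_quot_coords[OF assms(2)] by blast
  let ?n = "num (proj_quot u v)" and ?d = "den (proj_quot u v)"
  have uv: "\<tau> u = \<tau> k * \<tau> ?n" "\<tau> v = \<tau> k * \<tau> ?d"
    using k field_autsD(2)[OF assms(1)] by metis+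
  have "proj_quot (a * \<tau> u + b * \<tau> v) (c * \<tau> u + d * \<tau> v) =
    proj_quot (\<tau> k * (a * \<tau> ?n + b * \<tau> ?d)) (\<tau> k * (c * \<tau> ?n + d * \<tau> ?d))"
    unfolding uv by (simp add: algebra_simps)
  also have "\<dots> = proj_quot (a * \<tau> ?n + b * \<tau> ?d) (c * \<tau> ?n + d * \<tau> ?d)"
    by (rule proj_quot_scale) (simp add: k(1) field_autsD[OF assms(1)])
  finally show ?thesis by (simp add: semilinear_frac_num_den[OF assms(1)])
qed

text \<open>The matrix of a composition is the product of the first matrix with the image of the second under
  the first automorphism, because that automorphism is applied to the entries of the second
  matrix.\<close>

lemma semilinear_frac_comp:
  assumes \<sigma>: "\<sigma> \<in> field_auts" and \<tau>: "\<tau> \<in> field_auts" and det: "a' * d' - b' * c' \<noteq> 0"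
  shows "semilinear_frac a b c d \<sigma> (semilinear_frac a' b' c' d' \<tau> \<xi>) =
    semilinear_frac (a * \<sigma> a' + b * \<sigma> c') (a * \<sigma> b' + b * \<sigma> d')
      (c * \<sigma> a' + d * \<sigma> c') (c * \<sigma> b' + d * \<sigma> d') (\<lambda>x. \<sigma> (\<tau> x)) \<xi>"
proof -
  have "\<tau> (num \<xi>) \<noteq> 0 \<or> \<tau> (den \<xi>) \<noteq> 0"
    using num_den_nonzero[of \<xi>] by (simp add: field_autsD[OF \<tau>])
  note nz = invertible_image_nonzero[OF det this]
  show ?thesis
    unfolding semilinear_frac_num_den[OF \<tau>] semilinear_frac_proj_quot[OF \<sigma> nz]
      semilinear_frac_num_den[OF field_auts_comp[OF \<sigma> \<tau>]]
    by (simp add: field_autsD[OF \<sigma>] algebra_simps)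
qed

lemma semilinear_frac_scalar:
  assumes "k \<noteq> 0"
  shows "semilinear_frac k 0 0 k (\<lambda>x. x) \<xi> = \<xi>"
  using proj_quot_scale[OF assms, of "num \<xi>" "den \<xi>"]
  by (simp add: semilinear_frac_num_den field_auts_id proj_quot_num_den)

text \<open>The adjugate matrix, twisted by the inverse automorphism, inverts the map: both products are the
  determinant (or its image) times the identity, and scalar matrices act trivially.\<close>

lemma semilinear_frac_left_inverse:
  assumes \<tau>: "\<tau> \<in> field_auts" and det: "a * d - b * c \<noteq> 0"
  defines "\<sigma> \<equiv> inv_into UNIV \<tau>"
  shows "semilinear_frac (\<sigma> d) (\<sigma> (- b)) (\<sigma> (- c)) (\<sigma> a) \<sigma> (semilinear_frac a b c d \<tau> \<xi>) = \<xi>"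
    "semilinear_frac a b c d \<tau> (semilinear_frac (\<sigma> d) (\<sigma> (- b)) (\<sigma> (- c)) (\<sigma> a) \<sigma> \<xi>) = \<xi>"
    "\<sigma> d * \<sigma> a - \<sigma> (- b) * \<sigma> (- c) \<noteq> 0"
proof -
  have \<sigma>: "\<sigma> \<in> field_auts" using field_auts_inv[OF \<tau>] by (simp add: \<sigma>_def)
  have inv: "\<tau> (\<sigma> x) = x" "\<sigma> (\<tau> x) = x" for x
    using field_auts_inv[OF \<tau>] by (simp_all add: \<sigma>_def)
  note D = field_autsD[OF \<sigma>]
  have eq: "\<sigma> d * \<sigma> a - \<sigma> (- b) * \<sigma> (- c) = \<sigma> (a * d - b * c)" by (simp add: D)
  show det': "\<sigma> d * \<sigma> a - \<sigma> (- b) * \<sigma> (- c) \<noteq> 0" unfolding eq D(8) by (rule det)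
  have "semilinear_frac (\<sigma> d) (\<sigma> (- b)) (\<sigma> (- c)) (\<sigma> a) \<sigma> (semilinear_frac a b c d \<tau> \<xi>) =
    semilinear_frac (\<sigma> (a * d - b * c)) 0 0 (\<sigma> (a * d - b * c)) (\<lambda>x. x) \<xi>"
    unfolding semilinear_frac_comp[OF \<sigma> \<tau> det] by (simp add: D inv algebra_simps)
  then show "semilinear_frac (\<sigma> d) (\<sigma> (- b)) (\<sigma> (- c)) (\<sigma> a) \<sigma> (semilinear_frac a b c d \<tau> \<xi>) = \<xi>"
    using semilinear_frac_scalar[of "\<sigma> (a * d - b * c)"] det by (simp add: D(8))
  have "semilinear_frac a b c d \<tau> (semilinear_frac (\<sigma> d) (\<sigma> (- b)) (\<sigma> (- c)) (\<sigma> a) \<sigma> \<xi>) =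
    semilinear_frac (a * d - b * c) 0 0 (a * d - b * c) (\<lambda>x. x) \<xi>"
    unfolding semilinear_frac_comp[OF \<tau> \<sigma> det'] by (simp add: inv algebra_simps)
  then show "semilinear_frac a b c d \<tau> (semilinear_frac (\<sigma> d) (\<sigma> (- b)) (\<sigma> (- c)) (\<sigma> a) \<sigma> \<xi>) = \<xi>"
    using semilinear_frac_scalar[OF det] by simp
qed

section \<open>The group of semilinear fractional maps\<close>

lemma carrier_PGammaL2:
  "carrier PGammaL2 = {semilinear_frac a b c d \<tau> | a b c d \<tau>.
    a * d - b * c \<noteq> 0 \<and> \<tau> \<in> field_auts}"
  by (simp add: PGammaL2_def)

lemma PGammaL2I:
  "a * d - b * c \<noteq> 0 \<Longrightarrow> \<tau> \<in> field_auts \<Longrightarrow> semilinear_frac a b c d \<tau> \<in> carrier PGammaL2"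
  unfolding carrier_PGammaL2 by blast

lemma PGammaL2E:
  assumes "g \<in> carrier PGammaL2"
  obtains a b c d \<tau> where "a * d - b * c \<noteq> 0" "\<tau> \<in> field_auts" "g = semilinear_frac a b c d \<tau>"
  using assms unfolding carrier_PGammaL2 by blast

lemma bij_semilinear_frac:
  assumes "\<tau> \<in> field_auts" "a * d - b * c \<noteq> 0"
  shows "bij (semilinear_frac a b c d \<tau>)"
  by (rule bij_betw_byWitness[where f' = "semilinear_frac (inv_into UNIV \<tau> d) (inv_into UNIV \<tau> (- b))
      (inv_into UNIV \<tau> (- c)) (inv_into UNIV \<tau> a) (inv_into UNIV \<tau>)"])
    (simp_all add: semilinear_frac_left_inverse[OF assms])

lemma PGammaL2_bij: "g \<in> carrier PGammaL2 \<Longrightarrow> bij g"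
  by (auto simp: carrier_PGammaL2 bij_semilinear_frac)

lemma PGammaL2_closed:
  assumes "g \<in> carrier PGammaL2" "h \<in> carrier PGammaL2"
  shows "(\<lambda>\<xi>. g (h \<xi>)) \<in> carrier PGammaL2"
proof -
  obtain a b c d \<sigma> where g: "g = semilinear_frac a b c d \<sigma>" "a * d - b * c \<noteq> 0" "\<sigma> \<in> field_auts"
    using assms(1) unfolding carrier_PGammaL2 by blast
  obtain a' b' c' d' \<tau> where h: "h = semilinear_frac a' b' c' d' \<tau>" "a' * d' - b' * c' \<noteq> 0"
      "\<tau> \<in> field_auts"
    using assms(2) unfolding carrier_PGammaL2 by blast
  have "(a * \<sigma> a' + b * \<sigma> c') * (c * \<sigma> b' + d * \<sigma> d')
      - (a * \<sigma> b' + b * \<sigma> d') * (c * \<sigma> a' + d * \<sigma> c')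
    = (a * d - b * c) * \<sigma> (a' * d' - b' * c')"
    unfolding field_autsD[OF g(3)] by algebra
  then have "(a * \<sigma> a' + b * \<sigma> c') * (c * \<sigma> b' + d * \<sigma> d')
      - (a * \<sigma> b' + b * \<sigma> d') * (c * \<sigma> a' + d * \<sigma> c') \<noteq> 0"
    using g(2) h(2) by (simp add: field_autsD(8)[OF g(3)])
  moreover have "(\<lambda>\<xi>. g (h \<xi>)) = semilinear_frac (a * \<sigma> a' + b * \<sigma> c') (a * \<sigma> b' + b * \<sigma> d')
      (c * \<sigma> a' + d * \<sigma> c') (c * \<sigma> b' + d * \<sigma> d') (\<lambda>x. \<sigma> (\<tau> x))"
    unfolding g(1) h(1) using semilinear_frac_comp[OF g(3) h(3) h(2)] by blast
  ultimately show ?thesis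
    unfolding carrier_PGammaL2 using field_auts_comp[OF g(3) h(3)] by blast
qed

lemma PGammaL2_id: "(\<lambda>\<xi>. \<xi>) \<in> carrier PGammaL2"
proof -
  have "(\<lambda>\<xi>. \<xi>) = semilinear_frac (1::'a::field) 0 0 1 (\<lambda>x. x)"
    using semilinear_frac_scalar[of "1::'a"] by auto
  moreover have "(1::'a) * 1 - 0 * 0 \<noteq> 0" by simp
  ultimately show ?thesis unfolding carrier_PGammaL2 using field_auts_id by blast
qed

lemma PGammaL2_inverse:
  assumes "g \<in> carrier PGammaL2"
  obtains h where "h \<in> carrier PGammaL2" "\<And>\<xi>. h (g \<xi>) = \<xi>" "\<And>\<xi>. g (h \<xi>) = \<xi>"
proof -
  obtain a b c d \<tau> where g: "g = semilinear_frac a b c d \<tau>" "a * d - b * c \<noteq> 0" "\<tau> \<in> field_auts"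
    using assms unfolding carrier_PGammaL2 by blast
  let ?h = "semilinear_frac (inv_into UNIV \<tau> d) (inv_into UNIV \<tau> (- b)) (inv_into UNIV \<tau> (- c)) (inv_into UNIV \<tau> a) (inv_into UNIV \<tau>)"
  have "?h \<in> carrier PGammaL2"
    unfolding carrier_PGammaL2
    using semilinear_frac_left_inverse(3)[OF g(3,2)] field_auts_inv(1)[OF g(3)] by blast
  then show ?thesis
    using that semilinear_frac_left_inverse(1,2)[OF g(3,2)] g(1) by metis
qed

lemma mult_PGammaL2:
  assumes "g \<in> carrier PGammaL2" "h \<in> carrier PGammaL2"
  shows "g \<otimes>\<^bsub>PGammaL2\<^esub> h = (\<lambda>\<xi>. g (h \<xi>))"
  using assms[THEN PGammaL2_bij]
  by (simp add: PGammaL2_def BijGroup_def Bij_def compose_def restrict_def)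

lemma one_PGammaL2: "\<one>\<^bsub>PGammaL2\<^esub> = (\<lambda>\<xi>. \<xi>)"
  by (simp add: PGammaL2_def BijGroup_def restrict_def)

lemma group_PGammaL2: "group PGammaL2"
proof (rule groupI)
  show "\<one>\<^bsub>PGammaL2\<^esub> \<in> carrier PGammaL2"
    using PGammaL2_id by (simp add: one_PGammaL2)
  show "\<exists>y\<in>carrier PGammaL2. y \<otimes>\<^bsub>PGammaL2\<^esub> x = \<one>\<^bsub>PGammaL2\<^esub>"
    if x: "x \<in> carrier PGammaL2" for x :: "'a option \<Rightarrow> 'a option"
  proof -
    obtain h where "h \<in> carrier PGammaL2" "\<And>\<xi>. h (x \<xi>) = \<xi>" using PGammaL2_inverse[OF x] by blast
    then show ?thesis
      using mult_PGammaL2[OF _ x] by (intro bexI[of _ h]) (auto simp: one_PGammaL2)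
  qed
  show "\<one>\<^bsub>PGammaL2\<^esub> \<otimes>\<^bsub>PGammaL2\<^esub> x = x"
    if x: "x \<in> carrier PGammaL2" for x :: "'a option \<Rightarrow> 'a option"
    using mult_PGammaL2[OF PGammaL2_id x] by (simp add: one_PGammaL2)
qed (simp_all add: mult_PGammaL2 PGammaL2_closed)

text \<open>A semilinear fractional map determines its automorphism, and its matrix up to a scalar. The images of
  \<open>\<infinity>\<close> and \<open>0\<close> give the two columns up to separate factors \<open>k\<close> and \<open>l\<close>; the image of any
  \<open>x\<close> compares them, since the columns are linearly independent: at \<open>x = 1\<close> the factors must agree,
  and then at general \<open>x\<close> the automorphisms agree. This is what makes \<open>plane_action\<close>
  well defined.\<close>

lemma semilinear_frac_eqD:
  assumes det: "a * d - b * c \<noteq> 0" "a' * d' - b' * c' \<noteq> 0"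
    and \<tau>: "\<tau> \<in> field_auts" "\<tau>' \<in> field_auts"
    and eq: "semilinear_frac a b c d \<tau> = semilinear_frac a' b' c' d' \<tau>'"
  obtains k where "k \<noteq> 0" "a' = k * a" "b' = k * b" "c' = k * c" "d' = k * d" "\<tau>' = \<tau>"
proof -
  note D = field_autsD[OF \<tau>(1)] field_autsD[OF \<tau>(2)]
  have at: "proj_quot (a * \<tau> u + b * \<tau> v) (c * \<tau> u + d * \<tau> v)
    = proj_quot (a' * \<tau>' u + b' * \<tau>' v) (c' * \<tau>' u + d' * \<tau>' v)" if "u \<noteq> 0 \<or> v \<noteq> 0" for u v
    using semilinear_frac_proj_quot[OF \<tau>(1) that, of a b c d]
      semilinear_frac_proj_quot[OF \<tau>(2) that, of a' b' c' d'] eq by simp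
  have ex: "\<exists>k. k \<noteq> 0 \<and> a' * \<tau>' u + b' * \<tau>' v = k * (a * \<tau> u + b * \<tau> v) \<and>
     c' * \<tau>' u + d' * \<tau>' v = k * (c * \<tau> u + d * \<tau> v)" if uv: "u \<noteq> 0 \<or> v \<noteq> 0" for u v
  proof -
    have "\<tau> u \<noteq> 0 \<or> \<tau> v \<noteq> 0" "\<tau>' u \<noteq> 0 \<or> \<tau>' v \<noteq> 0" using uv by (simp_all add: D)
    from proj_quot_eqD[OF invertible_image_nonzero[OF det(1) this(1)]
        invertible_image_nonzero[OF det(2) this(2)] at[OF uv]]
    show ?thesis by metis
  qed
  have cancel: "p = 0 \<and> q = 0" if "p * a + q * b = 0" "p * c + q * d = 0" for p q
  proof -
    have "(a * d - b * c) * p = d * (p * a + q * b) - b * (p * c + q * d)"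
      "(a * d - b * c) * q = a * (p * c + q * d) - c * (p * a + q * b)" by algebra+
    then show ?thesis using that det(1) by simp
  qed
  obtain k where k: "k \<noteq> 0" "a' = k * a" "c' = k * c" using ex[of 1 0] by (auto simp: D)
  obtain l where l: "b' = l * b" "d' = l * d" using ex[of 0 1] by (auto simp: D)
  have scal: "\<exists>m. k * \<tau>' x = m * \<tau> x \<and> l = m" for x
  proof -
    obtain m where m: "a' * \<tau>' x + b' = m * (a * \<tau> x + b)" "c' * \<tau>' x + d' = m * (c * \<tau> x + d)"
      using ex[of x 1] by (auto simp: D)
    have "(k * \<tau>' x - m * \<tau> x) * a + (l - m) * b = 0" "(k * \<tau>' x - m * \<tau> x) * c + (l - m) * d = 0"
      using m unfolding k l by (simp_all add: algebra_simps)
    from cancel[OF this] show ?thesis by auto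
  qed
  \<comment> \<open>Automorphisms fix \<open>1\<close>, so there the common factor is both \<open>k\<close> and \<open>l\<close>.\<close>
  have kl: "l = k" using scal[of 1] by (auto simp: D)
  have "\<tau>' = \<tau>" using scal k(1) kl by auto
  then show ?thesis using that[of k] k l kl by simp
qed

section \<open>Cross-ratios and transitivity\<close>

text \<open>The determinant of the coordinate vectors of two points. It vanishes only for equal points, and a
  cross-ratio is a quotient of products of such determinants in which all scalings cancel.\<close>

definition bracket :: "'a::field option \<Rightarrow> 'a option \<Rightarrow> 'a" where
  "bracket \<xi> \<zeta> = num \<xi> * den \<zeta> - den \<xi> * num \<zeta>"

lemma bracket_eq_0_iff [simp]: "bracket \<xi> \<zeta> = 0 \<longleftrightarrow> \<xi> = \<zeta>"
  by (cases \<xi>; cases \<zeta>) (simp_all add: bracket_def)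

lemma cross_ratio_bracket:
  assumes "distinct [\<xi>, \<gamma>, \<alpha>, \<beta>]"
  shows "cross_ratio \<xi> \<gamma> \<alpha> \<beta> =
    (bracket \<xi> \<alpha> * bracket \<gamma> \<beta>) / (bracket \<xi> \<beta> * bracket \<gamma> \<alpha>)"
  using assms
  by (cases \<xi>; cases \<gamma>; cases \<alpha>; cases \<beta>)
    (simp_all add: bracket_def; metis minus_diff_eq minus_divide_divide)+

text \<open>The cross-ratio differs from \<open>1\<close> by the Pluecker relation between the six determinants of four
  vectors in the plane.\<close>

lemma cross_ratio_not_0_1:
  assumes "distinct [\<xi>, \<gamma>, \<alpha>, \<beta>]"
  shows "cross_ratio \<xi> \<gamma> \<alpha> \<beta> \<noteq> 0" "cross_ratio \<xi> \<gamma> \<alpha> \<beta> \<noteq> 1"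
proof -
  show "cross_ratio \<xi> \<gamma> \<alpha> \<beta> \<noteq> 0"
    using assms by (simp add: cross_ratio_bracket)
  have "bracket \<xi> \<alpha> * bracket \<gamma> \<beta> - bracket \<xi> \<beta> * bracket \<gamma> \<alpha> = bracket \<xi> \<gamma> * bracket \<alpha> \<beta>"
    unfolding bracket_def by algebra
  moreover have "bracket \<xi> \<gamma> * bracket \<alpha> \<beta> \<noteq> 0" using assms by simp
  ultimately show "cross_ratio \<xi> \<gamma> \<alpha> \<beta> \<noteq> 1"
    using assms by (auto simp: cross_ratio_bracket)
qed

lemma cross_ratio_swap:
  assumes "distinct [\<xi>, \<gamma>, \<alpha>, \<beta>]"
  shows "cross_ratio \<gamma> \<xi> \<alpha> \<beta> = inverse (cross_ratio \<xi> \<gamma> \<alpha> \<beta>)"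
    "cross_ratio \<xi> \<gamma> \<beta> \<alpha> = inverse (cross_ratio \<xi> \<gamma> \<alpha> \<beta>)"
    "cross_ratio \<alpha> \<beta> \<xi> \<gamma> = cross_ratio \<xi> \<gamma> \<alpha> \<beta>"
proof -
  have anti: "bracket \<zeta> \<eta> = - bracket \<eta> \<zeta>" for \<zeta> \<eta> :: "'a option" by (simp add: bracket_def)
  have d: "distinct [\<gamma>, \<xi>, \<alpha>, \<beta>]" "distinct [\<xi>, \<gamma>, \<beta>, \<alpha>]" "distinct [\<alpha>, \<beta>, \<xi>, \<gamma>]"
    using assms by auto
  show "cross_ratio \<gamma> \<xi> \<alpha> \<beta> = inverse (cross_ratio \<xi> \<gamma> \<alpha> \<beta>)"
    "cross_ratio \<xi> \<gamma> \<beta> \<alpha> = inverse (cross_ratio \<xi> \<gamma> \<alpha> \<beta>)"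
    unfolding cross_ratio_bracket[OF assms] cross_ratio_bracket[OF d(1)]
      cross_ratio_bracket[OF d(2)] by (simp_all add: mult.commute)
  show "cross_ratio \<alpha> \<beta> \<xi> \<gamma> = cross_ratio \<xi> \<gamma> \<alpha> \<beta>"
    unfolding cross_ratio_bracket[OF assms] cross_ratio_bracket[OF d(3)]
      anti[of \<alpha> \<xi>] anti[of \<beta> \<gamma>] anti[of \<alpha> \<gamma>] anti[of \<beta> \<xi>]
    by (simp add: mult.commute)
qed

text \<open>A matrix multiplies every determinant by its own determinant, and passing to normalised
  coordinates multiplies the determinant of \<open>\<zeta>\<close> and \<open>\<eta>\<close> by factors depending on \<open>\<zeta>\<close> and
  on \<open>\<eta>\<close> only. Each point occurs once in the numerator and once in the denominator of the cross-ratio,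
  so only \<open>\<tau>\<close> remains.\<close>

lemma cross_ratio_semilinear_frac:
  assumes det: "a * d - b * c \<noteq> 0" and \<tau>: "\<tau> \<in> field_auts"
    and dist: "distinct [\<xi>, \<gamma>, \<alpha>, \<beta>]"
  defines "g \<equiv> semilinear_frac a b c d \<tau>"
  shows "cross_ratio (g \<xi>) (g \<gamma>) (g \<alpha>) (g \<beta>) = \<tau> (cross_ratio \<xi> \<gamma> \<alpha> \<beta>)"
proof -
  note D = field_autsD[OF \<tau>]
  have "\<exists>k. k \<noteq> 0 \<and> a * \<tau> (num \<zeta>) + b * \<tau> (den \<zeta>) = k * num (g \<zeta>) \<and>
    c * \<tau> (num \<zeta>) + d * \<tau> (den \<zeta>) = k * den (g \<zeta>)" for \<zeta>
    unfolding g_def using semilinear_frac_coords[OF det \<tau>, of \<zeta>] by metis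
  then obtain k where k: "\<And>\<zeta>. k \<zeta> \<noteq> 0"
    "\<And>\<zeta>. a * \<tau> (num \<zeta>) + b * \<tau> (den \<zeta>) = k \<zeta> * num (g \<zeta>)"
    "\<And>\<zeta>. c * \<tau> (num \<zeta>) + d * \<tau> (den \<zeta>) = k \<zeta> * den (g \<zeta>)" by metis
  \<comment> \<open>This is \<open>det (M N) = det M * det N\<close> where \<open>N\<close> has the coordinates of \<open>\<zeta>\<close> and \<open>\<eta>\<close>,
    moved by \<open>\<tau>\<close>, as its columns.\<close>
  have bracket_g: "k \<zeta> * k \<eta> * bracket (g \<zeta>) (g \<eta>) = (a * d - b * c) * \<tau> (bracket \<zeta> \<eta>)" for \<zeta> \<eta>
  proof -
    have "k \<zeta> * k \<eta> * bracket (g \<zeta>) (g \<eta>) =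
      (k \<zeta> * num (g \<zeta>)) * (k \<eta> * den (g \<eta>)) - (k \<zeta> * den (g \<zeta>)) * (k \<eta> * num (g \<eta>))"
      by (simp add: bracket_def algebra_simps)
    also have "\<dots> = (a * d - b * c) * \<tau> (bracket \<zeta> \<eta>)"
      unfolding k(2,3)[symmetric] bracket_def D by algebra
    finally show ?thesis .
  qed
  have \<tau>_bracket:
    "\<tau> (bracket \<zeta> \<eta>) = k \<zeta> * k \<eta> * bracket (g \<zeta>) (g \<eta>) / (a * d - b * c)" for \<zeta> \<eta>
    unfolding bracket_g using det by simp
  have "inj g" unfolding g_def using bij_semilinear_frac[OF \<tau> det] by (rule bij_is_inj)
  then have dist': "distinct [g \<xi>, g \<gamma>, g \<alpha>, g \<beta>]" using dist by (auto dest: injD)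
  then show ?thesis
    unfolding cross_ratio_bracket[OF dist] cross_ratio_bracket[OF dist'] D \<tau>_bracket
    using det k(1) by simp
qed

lemma PGammaL2_cross_ratio:
  assumes "g \<in> carrier PGammaL2"
  obtains \<tau> where "\<tau> \<in> field_auts"
    "\<And>\<xi> \<gamma> \<alpha> \<beta>. distinct [\<xi>, \<gamma>, \<alpha>, \<beta>] \<Longrightarrow>
      cross_ratio (g \<xi>) (g \<gamma>) (g \<alpha>) (g \<beta>) = \<tau> (cross_ratio \<xi> \<gamma> \<alpha> \<beta>)"
proof -
  obtain a b c d \<tau> where "a * d - b * c \<noteq> 0" "\<tau> \<in> field_auts" "g = semilinear_frac a b c d \<tau>"
    using assms by (rule PGammaL2E)
  then show ?thesis using cross_ratio_semilinear_frac by (intro that[of \<tau>]) simp_all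
qed

lemma cross_ratio_standard: "cross_ratio None (Some 0) (Some 1) (Some r) = r"
  by simp

text \<open>The map is \<open>\<zeta> \<mapsto> (bracket \<zeta> \<gamma> * bracket \<alpha> \<xi>) / (bracket \<zeta> \<xi> * bracket \<alpha> \<gamma>)\<close>:
  it has a zero at \<open>\<gamma>\<close>, a pole at \<open>\<xi>\<close> and the value \<open>1\<close> at \<open>\<alpha>\<close>. No field automorphism
  is involved, so cross-ratios are unchanged.\<close>

lemma to_standard_position:
  assumes dist: "distinct [\<xi>, \<gamma>, \<alpha>]"
  obtains a b c d where "a * d - b * c \<noteq> 0"
    "semilinear_frac a b c d (\<lambda>x. x) \<xi> = None"
    "semilinear_frac a b c d (\<lambda>x. x) \<gamma> = Some 0"
    "semilinear_frac a b c d (\<lambda>x. x) \<alpha> = Some 1"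
proof
  let ?a = "den \<gamma> * bracket \<alpha> \<xi>" and ?b = "- num \<gamma> * bracket \<alpha> \<xi>"
    and ?c = "den \<xi> * bracket \<alpha> \<gamma>" and ?d = "- num \<xi> * bracket \<alpha> \<gamma>"
  have "?a * ?d - ?b * ?c = bracket \<alpha> \<xi> * bracket \<alpha> \<gamma> * bracket \<gamma> \<xi>"
    unfolding bracket_def by algebra
  moreover have "\<dots> \<noteq> 0" using dist by auto
  ultimately show "?a * ?d - ?b * ?c \<noteq> 0" by (rule ssubst)
  have up: "?a * num \<zeta> + ?b * den \<zeta> = bracket \<zeta> \<gamma> * bracket \<alpha> \<xi>"
    and low: "?c * num \<zeta> + ?d * den \<zeta> = bracket \<zeta> \<xi> * bracket \<alpha> \<gamma>" for \<zeta>
    unfolding bracket_def by algebra+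
  show "semilinear_frac ?a ?b ?c ?d (\<lambda>x. x) \<xi> = None"
    "semilinear_frac ?a ?b ?c ?d (\<lambda>x. x) \<gamma> = Some 0"
    "semilinear_frac ?a ?b ?c ?d (\<lambda>x. x) \<alpha> = Some 1"
    unfolding semilinear_frac_num_den[OF field_auts_id] up low
    using dist by (auto simp: proj_quot_def)
qed

lemma PGammaL2_triply_transitive:
  assumes "distinct [\<xi>, \<gamma>, \<alpha>]" "distinct [\<xi>', \<gamma>', \<alpha>']"
  obtains g where "g \<in> carrier PGammaL2" "g \<xi> = \<xi>'" "g \<gamma> = \<gamma>'" "g \<alpha> = \<alpha>'"
proof -
  have ex: "\<exists>g\<in>carrier PGammaL2. g \<xi> = None \<and> g \<gamma> = Some 0 \<and> g \<alpha> = Some 1"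
    if d: "distinct [\<xi>, \<gamma>, \<alpha>]" for \<xi> \<gamma> \<alpha> :: "'a option"
    by (rule to_standard_position[OF d]) (use PGammaL2I[OF _ field_auts_id] in blast)
  obtain g where g: "g \<in> carrier PGammaL2" "g \<xi> = None" "g \<gamma> = Some 0" "g \<alpha> = Some 1"
    using ex[OF assms(1)] by blast
  obtain h where h: "h \<in> carrier PGammaL2" "h \<xi>' = None" "h \<gamma>' = Some 0" "h \<alpha>' = Some 1"
    using ex[OF assms(2)] by blast
  obtain h' where h': "h' \<in> carrier PGammaL2" "\<And>\<zeta>. h' (h \<zeta>) = \<zeta>"
    using PGammaL2_inverse[OF h(1)] by blast
  show ?thesis
    by (rule that[OF PGammaL2_closed[OF h'(1) g(1)]])
       (simp_all add: g h'(2)[of \<xi>', unfolded h] h'(2)[of \<gamma>', unfolded h]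
         h'(2)[of \<alpha>', unfolded h])
qed

text \<open>Both quadruples are moved to standard position, where the fourth point is the cross-ratio itself;
  there the map \<open>\<tau>\<close> on coordinates fixes \<open>\<infinity>, 0, 1\<close> and takes one fourth point to the
  other.\<close>

lemma PGammaL2_cross_ratio_transitive:
  assumes dist: "distinct [\<xi>, \<gamma>, \<alpha>, \<beta>]" "distinct [\<xi>', \<gamma>', \<alpha>', \<beta>']"
    and \<tau>: "\<tau> \<in> field_auts"
    and cr: "cross_ratio \<xi>' \<gamma>' \<alpha>' \<beta>' = \<tau> (cross_ratio \<xi> \<gamma> \<alpha> \<beta>)"
  obtains g where "g \<in> carrier PGammaL2" "g \<xi> = \<xi>'" "g \<gamma> = \<gamma>'" "g \<alpha> = \<alpha>'" "g \<beta> = \<beta>'"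
proof -
  have ex: "\<exists>g\<in>carrier PGammaL2. g \<xi> = None \<and> g \<gamma> = Some 0 \<and> g \<alpha> = Some 1 \<and>
      g \<beta> = Some (cross_ratio \<xi> \<gamma> \<alpha> \<beta>)"
    if d: "distinct [\<xi>, \<gamma>, \<alpha>, \<beta>]" for \<xi> \<gamma> \<alpha> \<beta> :: "'a option"
  proof -
    have d3: "distinct [\<xi>, \<gamma>, \<alpha>]" using d by simp
    obtain a b c d' where
      det: "a * d' - b * c \<noteq> 0" and
      g: "semilinear_frac a b c d' (\<lambda>x. x) \<xi> = None"
        "semilinear_frac a b c d' (\<lambda>x. x) \<gamma> = Some 0"
        "semilinear_frac a b c d' (\<lambda>x. x) \<alpha> = Some 1"
      by (rule to_standard_position[OF d3])
    let ?g = "semilinear_frac a b c d' (\<lambda>x. x)"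
    have "?g \<beta> \<noteq> ?g \<xi>"
      using bij_semilinear_frac[OF field_auts_id det] d by (auto simp: bij_def dest: injD)
    then obtain y where y: "?g \<beta> = Some y" unfolding g by auto
    have "y = cross_ratio \<xi> \<gamma> \<alpha> \<beta>"
      using cross_ratio_semilinear_frac[OF det field_auts_id d] unfolding g y by simp
    moreover have "?g \<in> carrier PGammaL2"
      by (rule PGammaL2I[OF det field_auts_id])
    ultimately show ?thesis using g y by blast
  qed
  obtain g where g: "g \<in> carrier PGammaL2" "g \<xi> = None" "g \<gamma> = Some 0" "g \<alpha> = Some 1"
      "g \<beta> = Some (cross_ratio \<xi> \<gamma> \<alpha> \<beta>)"
    using ex[OF dist(1)] by blast
  obtain h where h: "h \<in> carrier PGammaL2" "h \<xi>' = None" "h \<gamma>' = Some 0" "h \<alpha>' = Some 1"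
      "h \<beta>' = Some (\<tau> (cross_ratio \<xi> \<gamma> \<alpha> \<beta>))"
    using ex[OF dist(2)] cr by auto
  obtain h' where h': "h' \<in> carrier PGammaL2" "\<And>\<zeta>. h' (h \<zeta>) = \<zeta>"
    using PGammaL2_inverse[OF h(1)] by blast
  let ?t = "semilinear_frac 1 0 0 1 \<tau>"
  have t: "?t \<in> carrier PGammaL2"
    by (rule PGammaL2I[OF _ \<tau>]) simp
  have t_simps: "?t None = None" "?t (Some x) = Some (\<tau> x)" for x
    by (simp_all add: semilinear_frac_def proj_quot_def)
  have "h' (?t (g \<xi>)) = \<xi>'" "h' (?t (g \<gamma>)) = \<gamma>'" "h' (?t (g \<alpha>)) = \<alpha>'" "h' (?t (g \<beta>)) = \<beta>'"
    using h'(2)[of \<xi>'] h'(2)[of \<gamma>'] h'(2)[of \<alpha>'] h'(2)[of \<beta>']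
    unfolding g t_simps h field_autsD(4,5)[OF \<tau>] by simp_all
  then show ?thesis
    by (rule that[OF PGammaL2_closed[OF h'(1) PGammaL2_closed[OF t g(1)]]])
qed

section \<open>The conic and its secants\<close>

definition veronese :: "'a::field \<Rightarrow> 'a \<Rightarrow> 'a ^ 3" where
  "veronese u v = vector [u\<^sup>2, u * v, v\<^sup>2]"

definition conic_vec :: "'a::field option \<Rightarrow> 'a ^ 3" where
  "conic_vec \<xi> = veronese (num \<xi>) (den \<xi>)"

lemma conic_point_eq_span: "conic_point \<xi> = vec.span {conic_vec \<xi>}"
  by (cases \<xi>) (simp_all add: conic_point_def conic_vec_def veronese_def)

lemma span_singleton_scale:
  fixes w :: "'a::field ^ 'n"
  assumes "k \<noteq> 0"
  shows "vec.span {k *s w} = vec.span {w}"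
proof (intro equalityI vec.span_minimal)
  show "{k *s w} \<subseteq> vec.span {w}"
    by (simp add: vec.span_scale vec.span_base)
  have "inverse k *s (k *s w) \<in> vec.span {k *s w}"
    by (intro vec.span_scale vec.span_base) simp
  then show "{w} \<subseteq> vec.span {k *s w}"
    using assms by simp
qed simp_all

lemma span_pair:
  fixes u v :: "'a::field ^ 'n"
  shows "w \<in> vec.span {u, v} \<longleftrightarrow> (\<exists>s t. w = s *s u + t *s v)"
  unfolding vec.span_breakdown_eq[of w u] vec.span_singleton image_iff
  by (simp add: diff_eq_eq add.commute)

lemma conic_vec_nonzero: "conic_vec \<xi> \<noteq> 0"
  by (cases \<xi>) (simp_all add: conic_vec_def veronese_def vec_eq_iff forall_3)

lemma conic_vec_independent:
  assumes "\<xi> \<noteq> \<gamma>" "s *s conic_vec \<xi> + t *s conic_vec \<gamma> = 0"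
  shows "s = 0 \<and> t = 0"
proof -
  have "s * (num \<xi>)\<^sup>2 + t * (num \<gamma>)\<^sup>2 = 0" "s * (num \<xi> * den \<xi>) + t * (num \<gamma> * den \<gamma>) = 0"
    "s * (den \<xi>)\<^sup>2 + t * (den \<gamma>)\<^sup>2 = 0"
    using assms(2) by (simp_all add: conic_vec_def veronese_def vec_eq_iff forall_3)
  moreover have "t = - s" if "s + t = 0" using that by (simp add: eq_neg_iff_add_eq_0 add.commute)
  ultimately show ?thesis
    using assms(1) by (cases \<xi>; cases \<gamma>) (auto simp: algebra_simps)
qed

lemma bracket_self: "bracket \<xi> \<xi> = 0"
  by simp

text \<open>The linear form whose zero set is the plane spanned by the vectors of two distinct conic
  points; on a conic vector it factors into the two determinants with these points.\<close>

definition chord_form :: "'a::field option \<Rightarrow> 'a option \<Rightarrow> 'a ^ 3 \<Rightarrow> 'a" where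
  "chord_form \<xi> \<gamma> w =
     den \<xi> * den \<gamma> * w $ 1 - (num \<xi> * den \<gamma> + den \<xi> * num \<gamma>) * w $ 2 + num \<xi> * num \<gamma> * w $ 3"

lemma chord_form_linear:
  "chord_form \<xi> \<gamma> (s *s u + t *s v) = s * chord_form \<xi> \<gamma> u + t * chord_form \<xi> \<gamma> v"
  unfolding chord_form_def vector_add_component vector_smult_component by algebra

lemma chord_form_conic_vec: "chord_form \<xi> \<gamma> (conic_vec \<delta>) = bracket \<xi> \<delta> * bracket \<gamma> \<delta>"
  unfolding chord_form_def conic_vec_def veronese_def bracket_def vector_3 by algebra

text \<open>The linear form of the chord vanishes on the span, and on a conic vector it is a product of two
  determinants; hence a line meets the conic in at most two points.\<close>

lemma conic_vec_in_chord:
  "conic_vec \<delta> \<in> vec.span {conic_vec \<xi>, conic_vec \<gamma>} \<longleftrightarrow> \<delta> = \<xi> \<or> \<delta> = \<gamma>"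
proof
  assume "conic_vec \<delta> \<in> vec.span {conic_vec \<xi>, conic_vec \<gamma>}"
  then obtain s t where "conic_vec \<delta> = s *s conic_vec \<xi> + t *s conic_vec \<gamma>"
    unfolding span_pair by blast
  then have "chord_form \<xi> \<gamma> (conic_vec \<delta>) = 0"
    by (simp add: chord_form_linear chord_form_conic_vec bracket_self)
  then show "\<delta> = \<xi> \<or> \<delta> = \<gamma>" by (auto simp: chord_form_conic_vec)
qed (auto intro: vec.span_base)

lemma pg2_points_iff: "P \<in> pg2_points \<longleftrightarrow> (\<exists>w. w \<noteq> 0 \<and> P = vec.span {w})"
proof
  assume "P \<in> pg2_points"
  then have P: "vec.subspace P" "vec.dim P = 1" by (auto simp: pg2_points_def)
  then have "\<not> P \<subseteq> {0}" using vec.dim_eq_0[of P] by auto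
  then obtain w where w: "w \<in> P" "w \<noteq> 0" by blast
  have "vec.span {w} \<subseteq> P" using w P(1) by (simp add: vec.span_minimal)
  then have "vec.span {w} = P"
    using w P by (intro vec.subspace_dim_equal) simp_all
  then show "\<exists>w. w \<noteq> 0 \<and> P = vec.span {w}" using w by blast
qed (auto simp: pg2_points_def)

lemma span_singleton_subset_iff:
  "vec.subspace W \<Longrightarrow> vec.span {w} \<subseteq> W \<longleftrightarrow> w \<in> W" for w :: "'a::field ^ 'n"
  using vec.span_minimal[of "{w}" W] vec.span_base[of w "{w}"] by auto

lemma points_in_subspace:
  assumes "vec.subspace W"
  shows "{P \<in> pg2_points. P \<subseteq> W} = {vec.span {w} | w. w \<noteq> 0 \<and> w \<in> W}"
  unfolding pg2_points_iff using span_singleton_subset_iff[OF assms] by auto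

lemma span_conic_points:
  "vec.span (conic_point \<xi> \<union> conic_point \<gamma>) = vec.span {conic_vec \<xi>, conic_vec \<gamma>}"
proof -
  have "vec.span (conic_point \<xi> \<union> conic_point \<gamma>) = vec.span ({conic_vec \<xi>} \<union> {conic_vec \<gamma>})"
    unfolding vec.span_Un conic_point_eq_span by (simp only: vec.span_span)
  then show ?thesis by (simp only: insert_is_Un[symmetric])
qed

lemma secant_eq:
  "secant \<xi> \<gamma> = {vec.span {w} | w. w \<noteq> 0 \<and> w \<in> vec.span {conic_vec \<xi>, conic_vec \<gamma>}}"
  unfolding secant_def span_conic_points by (rule points_in_subspace) simp

lemma secant_commute: "secant \<xi> \<gamma> = secant \<gamma> \<xi>"
  unfolding secant_def by (simp add: Un_commute)

lemma conic_point_in_pg2_points: "conic_point \<xi> \<in> pg2_points"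
  unfolding pg2_points_iff conic_point_eq_span using conic_vec_nonzero by blast

lemma conic_point_subset_iff:
  "conic_point \<delta> \<subseteq> vec.span {conic_vec \<xi>, conic_vec \<gamma>} \<longleftrightarrow> \<delta> = \<xi> \<or> \<delta> = \<gamma>"
  unfolding conic_point_eq_span by (simp add: span_singleton_subset_iff conic_vec_in_chord)

lemma inj_conic_point: "inj conic_point"
proof (rule injI)
  fix \<xi> \<gamma> :: "'a option"
  assume "conic_point \<xi> = conic_point \<gamma>"
  then show "\<xi> = \<gamma>"
    using conic_point_subset_iff[of \<xi> \<gamma> \<gamma>] by (simp add: conic_point_eq_span)
qed

lemma secant_Int_conic: "secant \<xi> \<gamma> \<inter> conic = {conic_point \<xi>, conic_point \<gamma>}"
proof -
  have "P \<in> secant \<xi> \<gamma> \<inter> conic \<longleftrightarrow> (\<exists>\<delta>. P = conic_point \<delta> \<and> (\<delta> = \<xi> \<or> \<delta> = \<gamma>))" for P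
    unfolding secant_def span_conic_points conic_def
    using conic_point_in_pg2_points conic_point_subset_iff[of _ \<xi> \<gamma>] by blast
  then show ?thesis by blast
qed

lemma secant_eq_iff:
  "secant \<xi> \<gamma> = secant \<alpha> \<beta> \<longleftrightarrow> {\<xi>, \<gamma>} = {\<alpha>, \<beta>}"
proof
  assume "secant \<xi> \<gamma> = secant \<alpha> \<beta>"
  then have "conic_point ` {\<xi>, \<gamma>} = conic_point ` {\<alpha>, \<beta>}"
    using secant_Int_conic[of \<xi> \<gamma>] secant_Int_conic[of \<alpha> \<beta>] by simp
  then show "{\<xi>, \<gamma>} = {\<alpha>, \<beta>}" by (simp only: inj_image_eq_iff[OF inj_conic_point])
next
  assume "{\<xi>, \<gamma>} = {\<alpha>, \<beta>}"
  then show "secant \<xi> \<gamma> = secant \<alpha> \<beta>"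
    by (auto simp: doubleton_eq_iff secant_commute)
qed

lemma dim_chord:
  assumes "\<xi> \<noteq> \<gamma>"
  shows "vec.dim (vec.span {conic_vec \<xi>, conic_vec \<gamma>}) = 2"
proof -
  have "conic_vec \<xi> \<notin> vec.span {conic_vec \<gamma>}"
    using conic_vec_in_chord[of \<xi> \<gamma> \<gamma>] assms by simp
  then show ?thesis
    by (simp add: vec.dim_insert conic_vec_nonzero)
qed

text \<open>A line with two conic points contains their span, which already has dimension two; conversely a
  secant contains no third conic point.\<close>

lemma hyperbolic_lines_eq:
  "hyperbolic_lines = {secant \<xi> \<gamma> | \<xi> \<gamma>. \<xi> \<noteq> \<gamma>}"
proof (intro equalityI subsetI)
  fix l :: "'a line" assume "l \<in> hyperbolic_lines"
  then obtain W where W: "vec.subspace W" "vec.dim W = 2" and l: "l = {P \<in> pg2_points. P \<subseteq> W}"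
    and card: "card (l \<inter> conic) = 2"
    unfolding hyperbolic_lines_def pg2_lines_def by blast
  obtain P Q where PQ: "l \<inter> conic = {P, Q}" "P \<noteq> Q" using card by (auto simp: card_2_iff)
  then have "P \<in> conic" "Q \<in> conic" "P \<subseteq> W" "Q \<subseteq> W" using l by auto
  then obtain \<xi> \<gamma> where \<xi>\<gamma>: "P = conic_point \<xi>" "Q = conic_point \<gamma>" by (auto simp: conic_def)
  then have ne: "\<xi> \<noteq> \<gamma>" using PQ by auto
  have "vec.span (conic_point \<xi> \<union> conic_point \<gamma>) \<subseteq> W"
    using \<open>P \<subseteq> W\<close> \<open>Q \<subseteq> W\<close> W(1) \<xi>\<gamma> by (intro vec.span_minimal) auto
  then have "vec.span (conic_point \<xi> \<union> conic_point \<gamma>) = W"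
    using W dim_chord[OF ne] unfolding span_conic_points
    by (intro vec.subspace_dim_equal) auto
  then show "l \<in> {secant \<xi> \<gamma> | \<xi> \<gamma>. \<xi> \<noteq> \<gamma>}" using ne l by (auto simp: secant_def)
next
  fix l :: "'a line" assume "l \<in> {secant \<xi> \<gamma> | \<xi> \<gamma>. \<xi> \<noteq> \<gamma>}"
  then obtain \<xi> \<gamma> where l: "l = secant \<xi> \<gamma>" and ne: "\<xi> \<noteq> \<gamma>" by blast
  have "l \<in> pg2_lines"
    unfolding l secant_def span_conic_points pg2_lines_def
    by (intro CollectI exI[of _ "vec.span {conic_vec \<xi>, conic_vec \<gamma>}"] conjI refl
        dim_chord[OF ne] vec.subspace_span)
  moreover have "card (l \<inter> conic) = 2"
    unfolding l secant_Int_conic card_2_iff 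
    by (intro exI conjI refl) (use ne inj_conic_point in \<open>auto dest: injD\<close>)
  ultimately show "l \<in> hyperbolic_lines" by (simp add: hyperbolic_lines_def)
qed

section \<open>The action on lines\<close>

lemma semilinear_map_component:
  "semilinear_map M \<tau> v $ i = (\<Sum>j\<in>UNIV. M $ i $ j * \<tau> (v $ j))"
  by (simp add: semilinear_map_def matrix_vector_mult_def)

lemma semilinear_map_add_scale:
  assumes "\<tau> \<in> field_auts"
  shows "semilinear_map M \<tau> (s *s u + t *s v) =
    \<tau> s *s semilinear_map M \<tau> u + \<tau> t *s semilinear_map M \<tau> v"
  by (simp add: vec_eq_iff semilinear_map_component field_autsD[OF assms] sum_3 algebra_simps)

lemma semilinear_map_scale:
  assumes "\<tau> \<in> field_auts"
  shows "semilinear_map M \<tau> (s *s u) = \<tau> s *s semilinear_map M \<tau> u"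
  using semilinear_map_add_scale[OF assms, of M s u 0 u] by (simp add: field_autsD(4)[OF assms])

lemma semilinear_map_image_span:
  assumes "\<tau> \<in> field_auts"
  shows "semilinear_map M \<tau> ` vec.span {w} = vec.span {semilinear_map M \<tau> w}"
proof -
  have "range \<tau> = UNIV" using field_autsD(3)[OF assms] by (simp add: bij_is_surj)
  moreover have "range (\<lambda>k. \<tau> k *s semilinear_map M \<tau> w) =
      (\<lambda>k. k *s semilinear_map M \<tau> w) ` range \<tau>"
    by (simp only: image_image)
  ultimately have "range (\<lambda>k. \<tau> k *s semilinear_map M \<tau> w) = range (\<lambda>k. k *s semilinear_map M \<tau> w)"
    by (simp only:)
  then show ?thesis
    unfolding vec.span_singleton image_image semilinear_map_scale[OF assms] .
qed

text \<open>The action on the plane is built so that the conic is equivariantly parametrised by the projective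
  line.\<close>

lemma sym_square_veronese:
  assumes "\<tau> \<in> field_auts"
  shows "semilinear_map (sym_square a b c d) \<tau> (veronese u v) =
    veronese (a * \<tau> u + b * \<tau> v) (c * \<tau> u + d * \<tau> v)"
  unfolding vec_eq_iff forall_3 semilinear_map_component sum_3 sym_square_def veronese_def
    vector_3 field_autsD(2,11)[OF assms]
  by (intro conjI; algebra)

lemma veronese_scale: "veronese (k * u) (k * v) = k\<^sup>2 *s veronese u v"
  by (simp add: vec_eq_iff forall_3 veronese_def power2_eq_square)

lemma sym_square_scale:
  "semilinear_map (sym_square (k * a) (k * b) (k * c) (k * d)) \<tau> v =
    k\<^sup>2 *s semilinear_map (sym_square a b c d) \<tau> v"
  unfolding vec_eq_iff forall_3 semilinear_map_component sum_3 sym_square_def vector_3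
    vector_smult_component
  by (intro conjI; algebra)

lemma sym_square_conic_vec:
  assumes "a * d - b * c \<noteq> 0" "\<tau> \<in> field_auts"
  obtains k where "k \<noteq> 0" "semilinear_map (sym_square a b c d) \<tau> (conic_vec \<xi>) =
    k *s conic_vec (semilinear_frac a b c d \<tau> \<xi>)"
proof -
  obtain k where k: "k \<noteq> 0"
    "a * \<tau> (num \<xi>) + b * \<tau> (den \<xi>) = k * num (semilinear_frac a b c d \<tau> \<xi>)"
    "c * \<tau> (num \<xi>) + d * \<tau> (den \<xi>) = k * den (semilinear_frac a b c d \<tau> \<xi>)"
    using semilinear_frac_coords[OF assms] by metis
  show ?thesis
    by (rule that[of "k\<^sup>2"])
      (simp_all add: k conic_vec_def sym_square_veronese[OF assms(2)] veronese_scale)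
qed

text \<open>Any representing matrix may be used: another one differs by a scalar \<open>k\<close>, its symmetric square
  differs by \<open>k\<^sup>2\<close>, and scalars fix all one-dimensional subspaces.\<close>

lemma plane_action_eq:
  assumes det: "a * d - b * c \<noteq> 0" and \<tau>: "\<tau> \<in> field_auts"
  shows "plane_action (semilinear_frac a b c d \<tau>) =
    (\<lambda>P\<in>pg2_points. semilinear_map (sym_square a b c d) \<tau> ` P)"
  unfolding plane_action_def
proof (rule the_equality)
  show "\<exists>a' b' c' d' \<tau>'. a' * d' - b' * c' \<noteq> 0 \<and> \<tau>' \<in> field_auts \<and>
      semilinear_frac a b c d \<tau> = semilinear_frac a' b' c' d' \<tau>' \<and>
      (\<lambda>P\<in>pg2_points. semilinear_map (sym_square a b c d) \<tau> ` P) =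
      (\<lambda>P\<in>pg2_points. semilinear_map (sym_square a' b' c' d') \<tau>' ` P)"
    using assms by blast
next
  fix h
  assume "\<exists>a' b' c' d' \<tau>'. a' * d' - b' * c' \<noteq> 0 \<and> \<tau>' \<in> field_auts \<and>
      semilinear_frac a b c d \<tau> = semilinear_frac a' b' c' d' \<tau>' \<and>
      h = (\<lambda>P\<in>pg2_points. semilinear_map (sym_square a' b' c' d') \<tau>' ` P)"
  then obtain a' b' c' d' \<tau>' where det': "a' * d' - b' * c' \<noteq> 0" and \<tau>': "\<tau>' \<in> field_auts"
    and eq: "semilinear_frac a b c d \<tau> = semilinear_frac a' b' c' d' \<tau>'"
    and h: "h = (\<lambda>P\<in>pg2_points. semilinear_map (sym_square a' b' c' d') \<tau>' ` P)"
    by blast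
  obtain k where k: "k \<noteq> 0" "a' = k * a" "b' = k * b" "c' = k * c" "d' = k * d" "\<tau>' = \<tau>"
    using semilinear_frac_eqD[OF det det' \<tau> \<tau>' eq] by blast
  have "semilinear_map (sym_square a' b' c' d') \<tau>' ` P = semilinear_map (sym_square a b c d) \<tau> ` P"
    if P: "P \<in> pg2_points" for P
  proof -
    obtain w where w: "P = vec.span {w}" using P unfolding pg2_points_iff by blast
    show ?thesis
      unfolding w semilinear_map_image_span[OF \<tau>'] semilinear_map_image_span[OF \<tau>]
      unfolding k sym_square_scale using k(1) by (simp add: span_singleton_scale)
  qed
  then show "h = (\<lambda>P\<in>pg2_points. semilinear_map (sym_square a b c d) \<tau> ` P)"
    unfolding h by (rule restrict_ext)
qed

text \<open>In terms of the vectors of the two conic points, a plane vector with coefficients \<open>s\<close> and \<open>t\<close> goes to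
  one with coefficients \<open>\<tau> s * k\<close> and \<open>\<tau> t * l\<close>, where \<open>k\<close> and \<open>l\<close> are nonzero. This is a
  bijection between nonzero coefficient pairs, hence between the points of the two lines.\<close>

lemma plane_action_secant:
  assumes det: "a * d - b * c \<noteq> 0" and \<tau>: "\<tau> \<in> field_auts" and ne: "\<xi> \<noteq> \<gamma>"
  defines "g \<equiv> semilinear_frac a b c d \<tau>"
  shows "plane_action g ` secant \<xi> \<gamma> = secant (g \<xi>) (g \<gamma>)"
proof -
  let ?F = "semilinear_map (sym_square a b c d) \<tau>"
  obtain k where k: "k \<noteq> 0" "?F (conic_vec \<xi>) = k *s conic_vec (g \<xi>)"
    using sym_square_conic_vec[OF det \<tau>] unfolding g_def by blast
  obtain l where l: "l \<noteq> 0" "?F (conic_vec \<gamma>) = l *s conic_vec (g \<gamma>)"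
    using sym_square_conic_vec[OF det \<tau>] unfolding g_def by blast
  have ne': "g \<xi> \<noteq> g \<gamma>"
    using bij_semilinear_frac[OF \<tau> det] ne unfolding g_def by (auto simp: bij_def dest: injD)
  have F: "?F (s *s conic_vec \<xi> + t *s conic_vec \<gamma>) =
      (\<tau> s * k) *s conic_vec (g \<xi>) + (\<tau> t * l) *s conic_vec (g \<gamma>)" for s t
    by (simp add: semilinear_map_add_scale[OF \<tau>] k l)
  have F0: "?F (s *s conic_vec \<xi> + t *s conic_vec \<gamma>) = 0 \<longleftrightarrow>
      s *s conic_vec \<xi> + t *s conic_vec \<gamma> = 0" for s t
  proof
    assume "?F (s *s conic_vec \<xi> + t *s conic_vec \<gamma>) = 0"
    then have "\<tau> s * k = 0 \<and> \<tau> t * l = 0"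
      unfolding F by (rule conic_vec_independent[OF ne'])
    then show "s *s conic_vec \<xi> + t *s conic_vec \<gamma> = 0"
      using k(1) l(1) by (simp add: field_autsD(8)[OF \<tau>])
  next
    assume "s *s conic_vec \<xi> + t *s conic_vec \<gamma> = 0"
    then have "s = 0 \<and> t = 0" by (rule conic_vec_independent[OF ne])
    then show "?F (s *s conic_vec \<xi> + t *s conic_vec \<gamma>) = 0"
      unfolding F by (simp add: field_autsD(4)[OF \<tau>])
  qed
  have "plane_action g ` secant \<xi> \<gamma> = (\<lambda>P. ?F ` P) ` secant \<xi> \<gamma>"
    unfolding g_def plane_action_eq[OF det \<tau>] by (rule image_cong) (auto simp: secant_def)
  also have "\<dots> = {vec.span {?F w} | w. w \<noteq> 0 \<and> w \<in> vec.span {conic_vec \<xi>, conic_vec \<gamma>}}"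
    unfolding secant_eq using semilinear_map_image_span[OF \<tau>] by blast
  also have "\<dots> = secant (g \<xi>) (g \<gamma>)"
    unfolding secant_eq
  proof (intro equalityI subsetI)
    fix P assume "P \<in> {vec.span {?F w} | w. w \<noteq> 0 \<and> w \<in> vec.span {conic_vec \<xi>, conic_vec \<gamma>}}"
    then obtain s t where st: "P = vec.span {?F (s *s conic_vec \<xi> + t *s conic_vec \<gamma>)}"
        "s *s conic_vec \<xi> + t *s conic_vec \<gamma> \<noteq> 0"
      unfolding span_pair by blast
    have "?F (s *s conic_vec \<xi> + t *s conic_vec \<gamma>) \<noteq> 0" using st(2) by (simp only: F0 not_False_eq_True)
    moreover have "?F (s *s conic_vec \<xi> + t *s conic_vec \<gamma>)
        \<in> vec.span {conic_vec (g \<xi>), conic_vec (g \<gamma>)}"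
      unfolding F span_pair by blast
    ultimately show "P \<in> {vec.span {w} | w. w \<noteq> 0 \<and>
        w \<in> vec.span {conic_vec (g \<xi>), conic_vec (g \<gamma>)}}"
      unfolding st(1) by blast
  next
    fix P assume "P \<in> {vec.span {w} | w. w \<noteq> 0 \<and>
        w \<in> vec.span {conic_vec (g \<xi>), conic_vec (g \<gamma>)}}"
    then obtain s t where st: "P = vec.span {s *s conic_vec (g \<xi>) + t *s conic_vec (g \<gamma>)}"
        "s *s conic_vec (g \<xi>) + t *s conic_vec (g \<gamma>) \<noteq> 0"
      unfolding span_pair by blast
    \<comment> \<open>The coefficients are chosen to undo the automorphism and the scalings.\<close>
    obtain s' where s': "\<tau> s' = s / k" using field_auts_inv(2)[OF \<tau>] by metis
    obtain t' where t': "\<tau> t' = t / l" using field_auts_inv(2)[OF \<tau>] by metis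
    let ?w = "s' *s conic_vec \<xi> + t' *s conic_vec \<gamma>"
    have Fw: "?F ?w = s *s conic_vec (g \<xi>) + t *s conic_vec (g \<gamma>)"
      unfolding F s' t' using k(1) l(1) by simp
    have "?w \<noteq> 0" using st(2) F0[of s' t'] unfolding Fw by blast
    moreover have "?w \<in> vec.span {conic_vec \<xi>, conic_vec \<gamma>}" unfolding span_pair by blast
    ultimately show "P \<in> {vec.span {?F w} | w. w \<noteq> 0 \<and>
        w \<in> vec.span {conic_vec \<xi>, conic_vec \<gamma>}}"
      unfolding st(1) Fw[symmetric] by blast
  qed
  finally show ?thesis .
qed

lemma line_action_secant:
  assumes "g \<in> carrier PGammaL2" "\<xi> \<noteq> \<gamma>"
  shows "line_action g (secant \<xi> \<gamma>) = secant (g \<xi>) (g \<gamma>)"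
proof -
  have "secant \<xi> \<gamma> \<in> hyperbolic_lines" unfolding hyperbolic_lines_eq using assms(2) by blast
  moreover have "plane_action g ` secant \<xi> \<gamma> = secant (g \<xi>) (g \<gamma>)"
    using assms(1) by (rule PGammaL2E) (simp add: plane_action_secant[OF _ _ assms(2)])
  ultimately show ?thesis by (simp add: line_action_def)
qed

lemma hyperbolic_linesE:
  assumes "l \<in> hyperbolic_lines"
  obtains \<xi> \<gamma> where "\<xi> \<noteq> \<gamma>" "l = secant \<xi> \<gamma>"
  using assms unfolding hyperbolic_lines_eq by blast

lemma secant_hyperbolic: "\<xi> \<noteq> \<gamma> \<Longrightarrow> secant \<xi> \<gamma> \<in> hyperbolic_lines"
  unfolding hyperbolic_lines_eq by blast

lemma PGammaL2_eq_iff: "g \<in> carrier PGammaL2 \<Longrightarrow> g \<xi> = g \<gamma> \<longleftrightarrow> \<xi> = \<gamma>"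
  using PGammaL2_bij[of g] by (auto simp: bij_def dest: injD)

lemma line_action_closed:
  assumes g: "g \<in> carrier PGammaL2" and l: "l \<in> hyperbolic_lines"
  shows "line_action g l \<in> hyperbolic_lines"
  using l by (rule hyperbolic_linesE)
    (simp add: line_action_secant[OF g] secant_hyperbolic PGammaL2_eq_iff[OF g])

lemma line_action_comp:
  assumes g: "g \<in> carrier PGammaL2" and h: "h \<in> carrier PGammaL2" and l: "l \<in> hyperbolic_lines"
  shows "line_action (\<lambda>\<xi>. g (h \<xi>)) l = line_action g (line_action h l)"
  using l by (rule hyperbolic_linesE)
    (simp add: line_action_secant g h PGammaL2_closed PGammaL2_eq_iff)

lemma line_action_id:
  assumes l: "l \<in> hyperbolic_lines"
  shows "line_action (\<lambda>\<xi>. \<xi>) l = l"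
  using l by (rule hyperbolic_linesE) (simp add: line_action_secant PGammaL2_id)

lemma line_action_bij:
  assumes g: "g \<in> carrier PGammaL2"
  shows "line_action g \<in> Bij hyperbolic_lines"
proof -
  obtain h where h: "h \<in> carrier PGammaL2" "\<And>\<xi>. h (g \<xi>) = \<xi>" "\<And>\<xi>. g (h \<xi>) = \<xi>"
    using PGammaL2_inverse[OF g] by blast
  have hg: "line_action h (line_action g l) = l" if l: "l \<in> hyperbolic_lines" for l
    using line_action_comp[OF h(1) g l] line_action_id[OF l] by (simp add: h(2))
  have gh: "line_action g (line_action h l) = l" if l: "l \<in> hyperbolic_lines" for l
    using line_action_comp[OF g h(1) l] line_action_id[OF l] by (simp add: h(3))
  have "bij_betw (line_action g) hyperbolic_lines hyperbolic_lines"
    by (rule bij_betw_byWitness[where f' = "line_action h"])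
      (use hg gh line_action_closed[OF g] line_action_closed[OF h(1)] in auto)
  then show ?thesis by (simp add: Bij_def line_action_def)
qed

text \<open>Transitivity on triples implies transitivity on pairs once every pair extends to a triple.\<close>

lemma third_point:
  assumes "\<xi> \<noteq> \<gamma>"
  obtains \<delta> :: "'a::field option" where "distinct [\<xi>, \<gamma>, \<delta>]"
proof -
  have "card {None, Some (0::'a), Some 1} = 3" by simp
  moreover have "card {\<xi>, \<gamma>} = 2" using assms by simp
  ultimately have "\<not> {None, Some 0, Some 1} \<subseteq> {\<xi>, \<gamma>}"
    using card_mono[of "{\<xi>, \<gamma>}" "{None, Some 0, Some 1}"] by fastforce
  then obtain \<delta> where "\<delta> \<notin> {\<xi>, \<gamma>}" by blast
  then show ?thesis using assms by (intro that[of \<delta>]) auto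
qed

lemma transitive_action_lines:
  "transitive_action PGammaL2 (hyperbolic_lines :: 'a::field line set) line_action"
proof -
  have "line_action (g \<otimes>\<^bsub>PGammaL2\<^esub> h) = compose hyperbolic_lines (line_action g) (line_action h)"
    if g: "g \<in> carrier PGammaL2" and h: "h \<in> carrier PGammaL2"
    for g h :: "'a option \<Rightarrow> 'a option"
  proof (rule extensionalityI)
    show "line_action (g \<otimes>\<^bsub>PGammaL2\<^esub> h) \<in> extensional hyperbolic_lines"
      by (simp add: line_action_def)
  next
    fix l :: "'a line" assume l: "l \<in> hyperbolic_lines"
    show "line_action (g \<otimes>\<^bsub>PGammaL2\<^esub> h) l
        = compose hyperbolic_lines (line_action g) (line_action h) l"
      using l by (simp add: mult_PGammaL2[OF g h] line_action_comp[OF g h l] compose_eq)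
  qed simp
  then have "line_action \<in> hom PGammaL2 (BijGroup (hyperbolic_lines :: 'a line set))"
    by (simp add: hom_def BijGroup_def line_action_bij)
  then have "group_action PGammaL2 (hyperbolic_lines :: 'a line set) line_action"
    unfolding group_action_def group_hom_def group_hom_axioms_def
    by (simp add: group_PGammaL2 group_BijGroup)
  moreover have "\<exists>g\<in>carrier PGammaL2. line_action g l = m"
    if l: "l \<in> hyperbolic_lines" and m: "m \<in> hyperbolic_lines" for l m :: "'a line"
  proof -
    obtain \<xi> \<gamma> where \<xi>\<gamma>: "\<xi> \<noteq> \<gamma>" "l = secant \<xi> \<gamma>" using l by (rule hyperbolic_linesE)
    obtain \<alpha> \<beta> where \<alpha>\<beta>: "\<alpha> \<noteq> \<beta>" "m = secant \<alpha> \<beta>" using m by (rule hyperbolic_linesE)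
    obtain \<delta> where \<delta>: "distinct [\<xi>, \<gamma>, \<delta>]" using \<xi>\<gamma>(1) by (rule third_point)
    obtain \<epsilon> where \<epsilon>: "distinct [\<alpha>, \<beta>, \<epsilon>]" using \<alpha>\<beta>(1) by (rule third_point)
    obtain g where "g \<in> carrier PGammaL2" "g \<xi> = \<alpha>" "g \<gamma> = \<beta>"
      using PGammaL2_triply_transitive[OF \<delta> \<epsilon>] by blast
    then show ?thesis using \<xi>\<gamma> \<alpha>\<beta> by (metis line_action_secant)
  qed
  ultimately show ?thesis
    by (simp add: transitive_action_def transitive_action_axioms_def)
qed

section \<open>The relations\<close>

lemma aut_classI: "\<tau> \<in> field_auts \<Longrightarrow> \<tau> r \<in> aut_class r"
  unfolding aut_class_def by (intro UnI1 CollectI exI[of _ \<tau>]) simp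

lemma aut_classE:
  assumes "x \<in> aut_class r"
  obtains \<tau> where "\<tau> \<in> field_auts" "x = \<tau> r \<or> x = inverse (\<tau> r)"
proof -
  have "(\<exists>\<tau>. x = \<tau> r \<and> \<tau> \<in> field_auts) \<or> (\<exists>\<tau>. x = inverse (\<tau> r) \<and> \<tau> \<in> field_auts)"
    using assms unfolding aut_class_def Un_iff mem_Collect_eq .
  then show ?thesis by (elim disjE exE conjE) (simp_all add: that)
qed

lemma aut_classI_inverse: "\<tau> \<in> field_auts \<Longrightarrow> inverse (\<tau> r) \<in> aut_class r"
  unfolding aut_class_def by (intro UnI2 CollectI exI[of _ \<tau>]) simp

lemma relI:
  assumes "distinct [\<xi>, \<gamma>, \<alpha>, \<beta>]" "cross_ratio \<xi> \<gamma> \<alpha> \<beta> \<in> aut_class r"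
  shows "(secant \<xi> \<gamma>, secant \<alpha> \<beta>) \<in> rel r"
  unfolding rel_def
  by (intro CollectI exI[of _ \<xi>] exI[of _ \<gamma>] exI[of _ \<alpha>] exI[of _ \<beta>] conjI refl assms)

lemma relE:
  assumes "p \<in> rel r"
  obtains \<xi> \<gamma> \<alpha> \<beta> where "p = (secant \<xi> \<gamma>, secant \<alpha> \<beta>)" "distinct [\<xi>, \<gamma>, \<alpha>, \<beta>]"
    "cross_ratio \<xi> \<gamma> \<alpha> \<beta> \<in> aut_class r"
  using assms unfolding rel_def mem_Collect_eq by (elim exE conjE) (rule that)

lemma rel_1I:
  assumes "distinct [\<xi>, \<gamma>, \<beta>]"
  shows "(secant \<xi> \<gamma>, secant \<xi> \<beta>) \<in> rel_1"
  unfolding rel_1_def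
  by (intro CollectI exI[of _ \<xi>] exI[of _ \<gamma>] exI[of _ \<beta>] conjI refl assms)

lemma rel_1E:
  assumes "p \<in> rel_1"
  obtains \<xi> \<gamma> \<beta> where "p = (secant \<xi> \<gamma>, secant \<xi> \<beta>)" "distinct [\<xi>, \<gamma>, \<beta>]"
  using assms unfolding rel_1_def mem_Collect_eq by (elim exE conjE) (rule that)

lemma aut_class_inverse: "x \<in> aut_class r \<Longrightarrow> inverse x \<in> aut_class r"
  by (erule aut_classE) (auto intro: aut_classI aut_classI_inverse)

lemma aut_class_refl: "r \<in> aut_class r"
  using aut_classI[OF field_auts_id] .

lemma aut_class_image:
  assumes "x \<in> aut_class r" "\<tau> \<in> field_auts"
  shows "\<tau> x \<in> aut_class r"
proof -
  obtain \<sigma> where \<sigma>: "\<sigma> \<in> field_auts" "x = \<sigma> r \<or> x = inverse (\<sigma> r)"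
    using assms(1) by (rule aut_classE)
  have "(\<lambda>y. \<tau> (\<sigma> y)) \<in> field_auts" by (rule field_auts_comp[OF assms(2) \<sigma>(1)])
  then have "\<tau> (\<sigma> r) \<in> aut_class r" by (rule aut_classI)
  then show ?thesis
    using \<sigma>(2) aut_class_inverse by (auto simp: field_autsD(9)[OF assms(2)])
qed

lemma aut_class_trans:
  assumes "x \<in> aut_class r'" "r' \<in> aut_class r"
  shows "x \<in> aut_class r"
proof -
  obtain \<tau> where "\<tau> \<in> field_auts" "x = \<tau> r' \<or> x = inverse (\<tau> r')"
    using assms(1) by (rule aut_classE)
  then show ?thesis using aut_class_image[OF assms(2)] aut_class_inverse by auto
qed

lemma aut_class_sym:
  assumes "x \<in> aut_class r"
  shows "r \<in> aut_class x"
proof -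
  obtain \<tau> where \<tau>: "\<tau> \<in> field_auts" and x: "x = \<tau> r \<or> x = inverse (\<tau> r)"
    using assms by (rule aut_classE)
  note inv = field_auts_inv[OF \<tau>]
  have "inv_into UNIV \<tau> x \<in> aut_class x" by (rule aut_class_image[OF aut_class_refl inv(1)])
  moreover have "inv_into UNIV \<tau> x = r \<or> inv_into UNIV \<tau> x = inverse r"
    using x by (auto simp: field_autsD(9)[OF inv(1)] inv(3))
  ultimately show ?thesis using aut_class_inverse[of "inverse r" x] by auto
qed

lemma aut_class_minus_1: "aut_class (- 1 :: 'a::field) = {- 1}"
proof (intro equalityI subsetI)
  fix x :: 'a assume "x \<in> aut_class (- 1)"
  then obtain \<tau> where "\<tau> \<in> field_auts" "x = \<tau> (- 1) \<or> x = inverse (\<tau> (- 1))"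
    by (rule aut_classE)
  then show "x \<in> {- 1}" by (auto simp: field_autsD(5,6))
qed (simp add: aut_class_refl)

lemma rel_minus_1_eq: "rel_minus_1 = rel (- 1)"
  by (simp add: rel_minus_1_def rel_def aut_class_minus_1)

section \<open>Orbits on pairs of secants\<close>

definition pair_orbit :: "'a::field line \<Rightarrow> 'a line \<Rightarrow> ('a line \<times> 'a line) set" where
  "pair_orbit l m = {(line_action g l, line_action g m) | g. g \<in> carrier PGammaL2}"

lemma pair_orbit_secants:
  assumes "\<xi> \<noteq> \<gamma>" "\<alpha> \<noteq> \<beta>"
  shows "pair_orbit (secant \<xi> \<gamma>) (secant \<alpha> \<beta>) =
    {(secant (g \<xi>) (g \<gamma>), secant (g \<alpha>) (g \<beta>)) | g. g \<in> carrier PGammaL2}"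
  unfolding pair_orbit_def
proof (rule Collect_cong, rule iff_exI)
  fix p g
  show "p = (line_action g (secant \<xi> \<gamma>), line_action g (secant \<alpha> \<beta>)) \<and> g \<in> carrier PGammaL2 \<longleftrightarrow>
      p = (secant (g \<xi>) (g \<gamma>), secant (g \<alpha>) (g \<beta>)) \<and> g \<in> carrier PGammaL2"
    using assms by (cases "g \<in> carrier PGammaL2") (simp_all add: line_action_secant)
qed

lemma pair_orbit_equal:
  assumes "\<xi> \<noteq> \<gamma>"
  shows "pair_orbit (secant \<xi> \<gamma>) (secant \<xi> \<gamma>) = rel_0"
  unfolding pair_orbit_secants[OF assms assms]
proof (intro equalityI subsetI)
  fix p assume "p \<in> {(secant (g \<xi>) (g \<gamma>), secant (g \<xi>) (g \<gamma>)) | g. g \<in> carrier PGammaL2}"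
  then obtain g where g: "g \<in> carrier PGammaL2" "p = (secant (g \<xi>) (g \<gamma>), secant (g \<xi>) (g \<gamma>))"
    by blast
  have "g \<xi> \<noteq> g \<gamma>" using assms by (simp add: PGammaL2_eq_iff[OF g(1)])
  then show "p \<in> rel_0" unfolding rel_0_def g(2) by blast
next
  fix p :: "'a line \<times> 'a line" assume "p \<in> rel_0"
  then obtain \<xi>' \<gamma>' where p: "\<xi>' \<noteq> \<gamma>'" "p = (secant \<xi>' \<gamma>', secant \<xi>' \<gamma>')"
    unfolding rel_0_def by blast
  obtain \<delta> where \<delta>: "distinct [\<xi>, \<gamma>, \<delta>]" using assms by (rule third_point)
  obtain \<epsilon> where \<epsilon>: "distinct [\<xi>', \<gamma>', \<epsilon>]" using p(1) by (rule third_point)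
  obtain g where "g \<in> carrier PGammaL2" "g \<xi> = \<xi>'" "g \<gamma> = \<gamma>'"
    using PGammaL2_triply_transitive[OF \<delta> \<epsilon>] by blast
  then show "p \<in> {(secant (g \<xi>) (g \<gamma>), secant (g \<xi>) (g \<gamma>)) | g. g \<in> carrier PGammaL2}"
    unfolding p(2) by (intro CollectI exI[of _ g]) simp
qed

lemma pair_orbit_meeting:
  assumes "distinct [\<xi>, \<gamma>, \<beta>]"
  shows "pair_orbit (secant \<xi> \<gamma>) (secant \<xi> \<beta>) = rel_1"
proof -
  have ne: "\<xi> \<noteq> \<gamma>" "\<xi> \<noteq> \<beta>" using assms by auto
  show ?thesis
    unfolding pair_orbit_secants[OF ne]
  proof (intro equalityI subsetI)
    fix p assume "p \<in> {(secant (g \<xi>) (g \<gamma>), secant (g \<xi>) (g \<beta>)) | g. g \<in> carrier PGammaL2}"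
    then obtain g where g: "g \<in> carrier PGammaL2"
        "p = (secant (g \<xi>) (g \<gamma>), secant (g \<xi>) (g \<beta>))" by blast
    have "distinct [g \<xi>, g \<gamma>, g \<beta>]" using assms by (simp add: PGammaL2_eq_iff[OF g(1)])
    then show "p \<in> rel_1" unfolding g(2) by (rule rel_1I)
  next
    fix p :: "'a line \<times> 'a line" assume "p \<in> rel_1"
    then obtain \<xi>' \<gamma>' \<beta>' where p: "p = (secant \<xi>' \<gamma>', secant \<xi>' \<beta>')" "distinct [\<xi>', \<gamma>', \<beta>']"
      by (rule rel_1E)
    obtain g where "g \<in> carrier PGammaL2" "g \<xi> = \<xi>'" "g \<gamma> = \<gamma>'" "g \<beta> = \<beta>'"
      using PGammaL2_triply_transitive[OF assms p(2)] by blast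
    then show "p \<in> {(secant (g \<xi>) (g \<gamma>), secant (g \<xi>) (g \<beta>)) | g. g \<in> carrier PGammaL2}"
      unfolding p(1) by (intro CollectI exI[of _ g]) simp
  qed
qed

text \<open>If the cross-ratio of the other pair is \<open>\<tau> r\<close>, the transitivity on quadruples applies directly; if
  it is \<open>inverse (\<tau> r)\<close>, it applies after exchanging the two parameters of its first
  line.\<close>

lemma pair_orbit_disjoint:
  assumes dist: "distinct [\<xi>, \<gamma>, \<alpha>, \<beta>]"
  shows "pair_orbit (secant \<xi> \<gamma>) (secant \<alpha> \<beta>) = rel (cross_ratio \<xi> \<gamma> \<alpha> \<beta>)"
proof -
  have ne: "\<xi> \<noteq> \<gamma>" "\<alpha> \<noteq> \<beta>" using assms by auto
  let ?r = "cross_ratio \<xi> \<gamma> \<alpha> \<beta>"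
  show ?thesis
    unfolding pair_orbit_secants[OF ne]
  proof (intro equalityI subsetI)
    fix p assume "p \<in> {(secant (g \<xi>) (g \<gamma>), secant (g \<alpha>) (g \<beta>)) | g. g \<in> carrier PGammaL2}"
    then obtain g where g: "g \<in> carrier PGammaL2"
        "p = (secant (g \<xi>) (g \<gamma>), secant (g \<alpha>) (g \<beta>))" by blast
    obtain \<tau> where "\<tau> \<in> field_auts" "cross_ratio (g \<xi>) (g \<gamma>) (g \<alpha>) (g \<beta>) = \<tau> ?r"
      using PGammaL2_cross_ratio[OF g(1)] dist by metis
    then have "cross_ratio (g \<xi>) (g \<gamma>) (g \<alpha>) (g \<beta>) \<in> aut_class ?r"
      by (simp add: aut_classI)
    moreover have "distinct [g \<xi>, g \<gamma>, g \<alpha>, g \<beta>]"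
      using dist by (simp add: PGammaL2_eq_iff[OF g(1)])
    ultimately show "p \<in> rel ?r" unfolding g(2) by (intro relI)
  next
    fix p assume "p \<in> rel ?r"
    then obtain \<xi>' \<gamma>' \<alpha>' \<beta>' where p: "p = (secant \<xi>' \<gamma>', secant \<alpha>' \<beta>')"
      and d: "distinct [\<xi>', \<gamma>', \<alpha>', \<beta>']" and cr: "cross_ratio \<xi>' \<gamma>' \<alpha>' \<beta>' \<in> aut_class ?r"
      by (rule relE)
    obtain \<tau> where \<tau>: "\<tau> \<in> field_auts"
      and "cross_ratio \<xi>' \<gamma>' \<alpha>' \<beta>' = \<tau> ?r \<or> cross_ratio \<xi>' \<gamma>' \<alpha>' \<beta>' = inverse (\<tau> ?r)"
      using cr by (rule aut_classE)
    then consider "cross_ratio \<xi>' \<gamma>' \<alpha>' \<beta>' = \<tau> ?r" | "cross_ratio \<gamma>' \<xi>' \<alpha>' \<beta>' = \<tau> ?r"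
      using cross_ratio_swap(1)[OF d] by auto
    then show "p \<in> {(secant (g \<xi>) (g \<gamma>), secant (g \<alpha>) (g \<beta>)) | g. g \<in> carrier PGammaL2}"
    proof cases
      case 1
      obtain g where "g \<in> carrier PGammaL2" "g \<xi> = \<xi>'" "g \<gamma> = \<gamma>'" "g \<alpha> = \<alpha>'" "g \<beta> = \<beta>'"
        using PGammaL2_cross_ratio_transitive[OF dist d \<tau> 1] by blast
      then show ?thesis unfolding p by (intro CollectI exI[of _ g]) simp
    next
      case 2
      have d': "distinct [\<gamma>', \<xi>', \<alpha>', \<beta>']" using d by auto
      obtain g where "g \<in> carrier PGammaL2" "g \<xi> = \<gamma>'" "g \<gamma> = \<xi>'" "g \<alpha> = \<alpha>'" "g \<beta> = \<beta>'"
        using PGammaL2_cross_ratio_transitive[OF dist d' \<tau> 2] by blast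
      then show ?thesis
        unfolding p secant_commute[of \<xi>' \<gamma>'] by (intro CollectI exI[of _ g]) simp
    qed
  qed
qed

lemma sym_rel:
  "sym (rel_0 :: ('a::field line \<times> 'a line) set)" "sym (rel_1 :: ('a line \<times> 'a line) set)"
  "sym (rel (r :: 'a))"
proof -
  show "sym (rel_0 :: ('a line \<times> 'a line) set)" by (auto simp: sym_def rel_0_def)
  show "sym (rel_1 :: ('a line \<times> 'a line) set)"
  proof (rule symI)
    fix l m :: "'a line" assume "(l, m) \<in> rel_1"
    then obtain \<xi> \<gamma> \<beta> where lm: "(l, m) = (secant \<xi> \<gamma>, secant \<xi> \<beta>)" and "distinct [\<xi>, \<gamma>, \<beta>]"
      by (rule rel_1E)
    then have "distinct [\<xi>, \<beta>, \<gamma>]" by auto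
    then show "(m, l) \<in> rel_1" using lm by (auto intro: rel_1I)
  qed
  show "sym (rel r)"
  proof (rule symI)
    fix l m :: "'a line" assume "(l, m) \<in> rel r"
    then obtain \<xi> \<gamma> \<alpha> \<beta> where lm: "(l, m) = (secant \<xi> \<gamma>, secant \<alpha> \<beta>)"
      and d: "distinct [\<xi>, \<gamma>, \<alpha>, \<beta>]" and cr: "cross_ratio \<xi> \<gamma> \<alpha> \<beta> \<in> aut_class r"
      by (rule relE)
    have "distinct [\<alpha>, \<beta>, \<xi>, \<gamma>]" using d by auto
    moreover have "cross_ratio \<alpha> \<beta> \<xi> \<gamma> \<in> aut_class r" using cr cross_ratio_swap(3)[OF d] by simp
    ultimately show "(m, l) \<in> rel r" using lm by (auto intro: relI)
  qed
qed

lemma pair_orbit_cases: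
  assumes "\<xi> \<noteq> \<gamma>" "\<alpha> \<noteq> \<beta>"
  shows "pair_orbit (secant \<xi> \<gamma>) (secant \<alpha> \<beta>) \<in> {rel_0, rel_1} \<union> {rel r | r. r \<notin> {0, 1}}"
proof -
  have meet: "pair_orbit (secant \<zeta> \<gamma>) (secant \<zeta> \<beta>) \<in> {rel_0, rel_1}"
    if "\<zeta> \<noteq> \<gamma>" "\<zeta> \<noteq> \<beta>" for \<zeta> \<gamma> \<beta> :: "'a option"
    using that pair_orbit_equal[of \<zeta> \<gamma>] pair_orbit_meeting[of \<zeta> \<gamma> \<beta>] by (cases "\<gamma> = \<beta>") auto
  consider "\<xi> = \<alpha>" | "\<xi> = \<beta>" | "\<gamma> = \<alpha>" | "\<gamma> = \<beta>" | "distinct [\<xi>, \<gamma>, \<alpha>, \<beta>]"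
    using assms by auto
  then show ?thesis
  proof cases
    case 1
    then show ?thesis using meet[of \<alpha> \<gamma> \<beta>] assms by auto
  next
    case 2
    then show ?thesis using meet[of \<beta> \<gamma> \<alpha>] assms secant_commute[of \<alpha> \<beta>] by auto
  next
    case 3
    then show ?thesis using meet[of \<alpha> \<xi> \<beta>] assms secant_commute[of \<xi> \<alpha>] by auto
  next
    case 4
    then show ?thesis
      using meet[of \<beta> \<xi> \<alpha>] assms secant_commute[of \<xi> \<beta>] secant_commute[of \<alpha> \<beta>] by auto
  next
    case 5
    then show ?thesis
      using pair_orbit_disjoint[OF 5] cross_ratio_not_0_1[OF 5] by blast
  qed
qed

text \<open>Every \<open>r\<close> other than \<open>0\<close> and \<open>1\<close> is a cross-ratio, so no \<open>rel r\<close> of this kind is empty.\<close>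

lemma pair_orbit_standard:
  assumes "r \<notin> {0, 1}"
  shows "distinct [None, Some 0, Some 1, Some r]"
    "pair_orbit (secant None (Some 0)) (secant (Some 1) (Some r)) = rel r"
proof -
  show d: "distinct [None, Some 0, Some 1, Some r]" using assms by auto
  show "pair_orbit (secant None (Some 0)) (secant (Some 1) (Some r)) = rel r"
    using pair_orbit_disjoint[OF d] cross_ratio_standard[of r] by simp
qed

lemma orbital_relations_lines:
  "orbital_relations PGammaL2 (hyperbolic_lines :: 'a::field line set) line_action =
    {rel_0, rel_1} \<union> {rel r | r. r \<notin> {0, 1}}" (is "?L = ?R")
proof -
  interpret transitive_action PGammaL2 "hyperbolic_lines :: 'a line set" line_action
    by (rule transitive_action_lines)
  have L: "?L = {pair_orbit l m | l m. l \<in> hyperbolic_lines \<and> m \<in> hyperbolic_lines}"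
    unfolding pair_orbit_def by (rule orbital_relations_eq)
  show ?thesis
  proof (intro equalityI subsetI)
    fix R assume "R \<in> ?L"
    then obtain l m where lm: "l \<in> hyperbolic_lines" "m \<in> hyperbolic_lines" "R = pair_orbit l m"
      unfolding L by blast
    obtain \<xi> \<gamma> where \<xi>\<gamma>: "\<xi> \<noteq> \<gamma>" "l = secant \<xi> \<gamma>" using lm(1) by (rule hyperbolic_linesE)
    obtain \<alpha> \<beta> where \<alpha>\<beta>: "\<alpha> \<noteq> \<beta>" "m = secant \<alpha> \<beta>" using lm(2) by (rule hyperbolic_linesE)
    show "R \<in> ?R"
      unfolding lm(3) \<xi>\<gamma>(2) \<alpha>\<beta>(2) by (rule pair_orbit_cases[OF \<xi>\<gamma>(1) \<alpha>\<beta>(1)])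
  next
    fix R assume R: "R \<in> ?R"
    have orb: "pair_orbit (secant \<xi> \<gamma>) (secant \<alpha> \<beta>) \<in> ?L" if "\<xi> \<noteq> \<gamma>" "\<alpha> \<noteq> \<beta>" for \<xi> \<gamma> \<alpha> \<beta> :: "'a option"
      unfolding L using secant_hyperbolic[OF that(1)] secant_hyperbolic[OF that(2)] by blast
    consider "R = rel_0" | "R = rel_1" | r where "r \<notin> {0, 1}" "R = rel r" using R by blast
    then show "R \<in> ?L"
    proof cases
      case 1
      then show ?thesis
        using orb[of None "Some 0" None "Some 0"] pair_orbit_equal[of None "Some (0::'a)"] by simp
    next
      case 2
      then show ?thesis
        using orb[of None "Some 0" None "Some 1"] pair_orbit_meeting[of None "Some (0::'a)" "Some 1"]
        by simp
    next
      case 3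
      then show ?thesis
        using orb[of None "Some 0" "Some 1" "Some r"] pair_orbit_standard[OF 3(1)] by simp
    qed
  qed
qed

text \<open>Two lines determine the cross-ratio of their parameters only up to inversion, since the parameters of
  each line are unordered.\<close>

lemma cross_ratio_secants:
  assumes "secant \<xi> \<gamma> = secant \<xi>' \<gamma>'" "secant \<alpha> \<beta> = secant \<alpha>' \<beta>'"
    and d: "distinct [\<xi>, \<gamma>, \<alpha>, \<beta>]"
  shows "cross_ratio \<xi>' \<gamma>' \<alpha>' \<beta>' \<in> {cross_ratio \<xi> \<gamma> \<alpha> \<beta>, inverse (cross_ratio \<xi> \<gamma> \<alpha> \<beta>)}"
proof -
  have "\<xi>' = \<xi> \<and> \<gamma>' = \<gamma> \<or> \<xi>' = \<gamma> \<and> \<gamma>' = \<xi>" "\<alpha>' = \<alpha> \<and> \<beta>' = \<beta> \<or> \<alpha>' = \<beta> \<and> \<beta>' = \<alpha>"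
    using assms(1,2) unfolding secant_eq_iff doubleton_eq_iff by auto
  moreover have "distinct [\<gamma>, \<xi>, \<alpha>, \<beta>]" using d by auto
  ultimately show ?thesis
    using cross_ratio_swap(1,2)[OF d] cross_ratio_swap(2)[of \<gamma> \<xi> \<alpha> \<beta>] by auto
qed

text \<open>Equality of the relations is tested on the pair of lines with parameters \<open>\<infinity>, 0\<close> and
  \<open>1, r'\<close>.\<close>

lemma rel_eq_iff:
  assumes "r \<notin> {0, 1}" "r' \<notin> {0, 1}"
  shows "rel r = rel r' \<longleftrightarrow> r' \<in> aut_class r"
proof
  assume eq: "rel r = rel r'"
  have "(secant None (Some 0), secant (Some 1) (Some r')) \<in> rel r'"
    by (rule relI[OF pair_orbit_standard(1)[OF assms(2)]])
       (simp only: cross_ratio_standard aut_class_refl)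
  then have "(secant None (Some 0), secant (Some 1) (Some r')) \<in> rel r" unfolding eq .
  then obtain \<xi> \<gamma> \<alpha> \<beta> where
    "(secant None (Some 0), secant (Some 1) (Some r')) = (secant \<xi> \<gamma>, secant \<alpha> \<beta>)"
    "distinct [\<xi>, \<gamma>, \<alpha>, \<beta>]" and cr: "cross_ratio \<xi> \<gamma> \<alpha> \<beta> \<in> aut_class r"
    by (rule relE)
  then have "cross_ratio None (Some 0) (Some 1) (Some r')
      \<in> {cross_ratio \<xi> \<gamma> \<alpha> \<beta>, inverse (cross_ratio \<xi> \<gamma> \<alpha> \<beta>)}"
    by (intro cross_ratio_secants) simp_all
  then show "r' \<in> aut_class r"
    unfolding cross_ratio_standard using cr aut_class_inverse by blast
next
  assume "r' \<in> aut_class r"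
  then have "aut_class r' = aut_class r" using aut_class_trans aut_class_sym by blast
  then show "rel r = rel r'" by (simp add: rel_def)
qed

text \<open>Shifting by \<open>1\<close> permutes the field, so comparing the sums of all elements before and after shows that
  \<open>CARD('a)\<close> is zero in the field; if \<open>2\<close> were zero as well, the odd number
  \<open>CARD('a)\<close> would also be one there.\<close>

lemma odd_card_imp_minus_1_neq_1:
  assumes "odd CARD('a::{field, finite})"
  shows "(- 1 :: 'a) \<noteq> 1"
proof
  assume "(- 1 :: 'a) = 1"
  then have two: "(2 :: 'a) = 0" by (simp add: eq_neg_iff_add_eq_0 neg_eq_iff_add_eq_0)
  have "(\<Sum>x\<in>(UNIV :: 'a set). x + 1) = (\<Sum>x\<in>UNIV. x)"
    by (rule sum.reindex_bij_witness[of _ "\<lambda>x. x - 1" "\<lambda>x. x + 1"]) auto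
  then have card: "of_nat CARD('a) = (0 :: 'a)" by (simp add: sum.distrib)
  obtain k where "CARD('a) = 2 * k + 1" using assms by (rule oddE)
  then have "of_nat CARD('a) = (1 :: 'a)" by (simp only: of_nat_add of_nat_mult of_nat_numeral two of_nat_1) simp
  then show False using card by simp
qed

theorem theorem3p4:
  fixes q :: nat
  assumes "primepow q" and "odd q"
    and "CARD('a::{field, finite}) = q"
  shows "transitive_action PGammaL2 (hyperbolic_lines :: 'a line set) line_action \<and>
         symmetric_association_scheme (hyperbolic_lines :: 'a line set)
           (orbital_relations PGammaL2 hyperbolic_lines line_action) \<and>
         orbital_relations PGammaL2 (hyperbolic_lines :: 'a line set) line_action =
           {rel_0, rel_1, rel_minus_1} \<union> {rel r | r. r \<notin> {0, 1, - 1}} \<and>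
         (\<forall>r r' :: 'a. r \<notin> {0, 1, - 1} \<longrightarrow> r' \<notin> {0, 1, - 1} \<longrightarrow>
           (rel r = rel r' \<longleftrightarrow> r' \<in> aut_class r))"
proof (intro conjI allI impI)
  interpret transitive_action PGammaL2 "hyperbolic_lines :: 'a line set" line_action
    by (rule transitive_action_lines)
  show "transitive_action PGammaL2 (hyperbolic_lines :: 'a line set) line_action"
    by (rule transitive_action_lines)
  show "symmetric_association_scheme (hyperbolic_lines :: 'a line set)
      (orbital_relations PGammaL2 hyperbolic_lines line_action)"
  proof (rule symmetric_association_scheme_orbital_relations)
    show "finite (hyperbolic_lines :: 'a line set)" by (rule finite)
    show "(hyperbolic_lines :: 'a line set) \<noteq> {}"
      using secant_hyperbolic[of None "Some (0::'a)"] by auto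
    show "sym R" if "R \<in> orbital_relations PGammaL2 (hyperbolic_lines :: 'a line set) line_action" for R
      using that sym_rel unfolding orbital_relations_lines by blast
  qed
  have "(- 1 :: 'a) \<notin> {0, 1}" using odd_card_imp_minus_1_neq_1[where 'a = 'a] assms(2,3) by simp
  then have "{rel r | r :: 'a. r \<notin> {0, 1}} = {rel (- 1)} \<union> {rel r | r. r \<notin> {0, 1, - 1}}" by blast
  then show "orbital_relations PGammaL2 (hyperbolic_lines :: 'a line set) line_action =
      {rel_0, rel_1, rel_minus_1} \<union> {rel r | r. r \<notin> {0, 1, - 1}}"
    unfolding orbital_relations_lines rel_minus_1_eq by auto
  show "rel r = rel r' \<longleftrightarrow> r' \<in> aut_class r"
    if "r \<notin> {0, 1, - 1}" "r' \<notin> {0, 1, - 1}" for r r' :: 'a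
    using that by (intro rel_eq_iff) auto
qed

end
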